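(* Let $M$ be a $C^\infty$ manifold of dimension $n$, let $(x,U)$ be a coordinate chart of $M$, and let $\omega$ be a two-tensor on $M$ with local expression on $U$ $$\omega=\sum_{p,q=1}^n a_{pq}\,dx^p\otimes dx^q,$$ where each $a_{pq}:U\to\mathbf{R}$ is $C^\infty$. Then, on $U$, the Leibniz coboundary of $\omega$ is $$d\omega=\sum_{p,q=1}^n\Bigg\{\sum_{\ell=1}^n\frac{\partial a_{pq}}{\partial x^\ell}\,dx^\ell\otimes dx^p\otimes dx^q-\sum_{\ell=1}^n\frac{\partial a_{pq}}{\partial x^\ell}\,dx^p\otimes dx^\ell\otimes dx^q+\sum_{\ell=1}^n\frac{\partial a_{pq}}{\partial x^\ell}\,dx^p\otimes dx^q\otimes dx^\ell$$ $$\qquad+\sum_{\ell=1}^n a_{pq}\,dx^\ell\otimes dx^p\otimes\Big(\frac{\partial}{\partial x^\ell}\circ dx^q\Big)+\sum_{\ell=1}^n a_{pq}\,dx^\ell\otimes dx^q\otimes\Big(\frac{\partial}{\partial x^\ell}\circ dx^p\Big)\Bigg\}.$$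
   Context: $\chi(M)$ denotes the Lie algebra of $C^\infty$ vector fields on $M$ (similarly $\chi(U)$). A $k$-tensor on $M$ is a $C^\infty$ section of $T^*(M)^{\otimes k}$ (no symmetry assumed); it determines an $\mathbf{R}$-linear map $\chi(M)^{\otimes k}\to C^\infty(M)$ by $\omega(X_1\otimes\cdots\otimes X_k)(p)=\omega(X_1(p)\otimes\cdots\otimes X_k(p))$. The Leibniz coboundary of an $\mathbf{R}$-linear map $\alpha:\chi(M)^{\otimes k}\to C^\infty(M)$ is $$d\alpha(X_1\otimes\cdots\otimes X_{k+1})=\sum_{i=1}^{k+1}(-1)^{i+1}X_i\big(\alpha(X_1\otimes\cdots\hat X_i\cdots\otimes X_{k+1})\big)+\sum_{1\le i<j\le k+1}(-1)^{j+1}\alpha\big(X_1\otimes\cdots\otimes X_{i-1}\otimes[X_i,X_j]\otimes X_{i+1}\otimes\cdots\hat X_j\cdots\otimes X_{k+1}\big).$$ For a $k$-tensor $\omega$, the value of $d\omega(X_1\otimes\cdots\otimes X_{k+1})$ at a point depends only on the $X_i$ near that point, so $d\omega$ can be evaluated at $p\in U$ on vector fields $X_i\in\chi(U)$ by replacing them with global vector fields $Y_i\in\chi(M)$ that agree with $X_i$ on a neighborhood of $p$. The operator $\frac{\partial}{\partial x^\ell}\circ dx^p:\chi(U)\to C^\infty(U)$ is given by $$\Big(\frac{\partial}{\partial x^\ell}\circ dx^p\Big)\Big(\sum_{i=1}^n b_i\frac{\partial}{\partial x^i}\Big)=\frac{\partial b_p}{\partial x^\ell}.$$ A tensor product $A_1\otimes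 A_2\otimes A_3$ of $\mathbf{R}$-linear operators $A_i:\chi(U)\to C^\infty(U)$ acts on $X_1\otimes X_2\otimes X_3$ as the product of functions $A_1(X_1)A_2(X_2)A_3(X_3)$. *)

theory Defs
  imports "HOL-Analysis.Analysis"
begin

section \<open>Smooth maps between open subsets of Euclidean spaces\<close>

fun higher_differentiable_on ::
    "nat \<Rightarrow> 'a::real_normed_vector set \<Rightarrow> ('a \<Rightarrow> 'b::real_normed_vector) \<Rightarrow> bool" where
  "higher_differentiable_on 0 S f \<longleftrightarrow> continuous_on S f"
| "higher_differentiable_on (Suc k) S f \<longleftrightarrow>
     (\<forall>z\<in>S. f differentiable (at z)) \<and>
     (\<forall>v. higher_differentiable_on k S (\<lambda>z. frechet_derivative f (at z) v))"

text \<open>Used for open \<open>S\<close> only.\<close>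

definition smooth_on :: "'a::real_normed_vector set \<Rightarrow> ('a \<Rightarrow> 'b::real_normed_vector) \<Rightarrow> bool" where
  "smooth_on S f \<longleftrightarrow> (\<forall>k. higher_differentiable_on k S f)"


section \<open>Smooth manifolds\<close>

text \<open>The points form an abstract topological space and the smooth structure is a maximal atlas.
  A chart is a pair \<open>(U, x)\<close>; the values of \<open>x\<close> outside \<open>U\<close> are irrelevant.\<close>

record ('m, 'n) manifold =
  space_of :: "'m topology"
  atlas :: "('m set \<times> ('m \<Rightarrow> real ^ 'n)) set"

abbreviation points :: "('m, 'n::finite) manifold \<Rightarrow> 'm set" where
  "points M \<equiv> topspace (space_of M)"

definition topological_chart :: "'m topology \<Rightarrow> 'm set \<Rightarrow> ('m \<Rightarrow> real ^ 'n) \<Rightarrow> bool" where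
  "topological_chart T U x \<longleftrightarrow>
     openin T U \<and> open (x ` U) \<and>
     homeomorphic_map (subtopology T U) (top_of_set (x ` U)) x"

definition smoothly_compatible ::
    "'m set \<Rightarrow> ('m \<Rightarrow> real ^ 'n) \<Rightarrow> 'm set \<Rightarrow> ('m \<Rightarrow> real ^ 'n) \<Rightarrow> bool" where
  "smoothly_compatible U x V y \<longleftrightarrow>
     smooth_on (x ` (U \<inter> V)) (y \<circ> inv_into U x) \<and>
     smooth_on (y ` (U \<inter> V)) (x \<circ> inv_into V y)"

definition smooth_manifold :: "('m, 'n::finite) manifold \<Rightarrow> bool" where
  "smooth_manifold M \<longleftrightarrow>
     Hausdorff_space (space_of M) \<and> second_countable (space_of M) \<and>
     (\<forall>(U, x)\<in>atlas M. topological_chart (space_of M) U x) \<and>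
     (\<Union>(U, x)\<in>atlas M. U) = points M \<and>
     (\<forall>(U, x)\<in>atlas M. \<forall>(V, y)\<in>atlas M. smoothly_compatible U x V y) \<and>
     (\<forall>U x. topological_chart (space_of M) U x \<and>
            (\<forall>(V, y)\<in>atlas M. smoothly_compatible U x V y) \<longrightarrow> (U, x) \<in> atlas M)"

text \<open>Real functions on an open subset \<open>W\<close> are represented by total functions whose values
  outside \<open>W\<close> are irrelevant; \<open>smooth_fun M W f\<close> says that \<open>f\<close> restricts to an
  element of \<open>C\<^sup>\<infinity>(W)\<close>.\<close>

definition smooth_fun :: "('m, 'n::finite) manifold \<Rightarrow> 'm set \<Rightarrow> ('m \<Rightarrow> real) \<Rightarrow> bool" where
  "smooth_fun M W f \<longleftrightarrow>
     openin (space_of M) W \<and>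
     (\<forall>(U, x)\<in>atlas M. smooth_on (x ` (U \<inter> W)) (f \<circ> inv_into U x))"

definition smooth_near :: "('m, 'n::finite) manifold \<Rightarrow> 'm \<Rightarrow> ('m \<Rightarrow> real) \<Rightarrow> bool" where
  "smooth_near M u f \<longleftrightarrow> (\<exists>W. u \<in> W \<and> smooth_fun M W f)"

text \<open>Equality of germs at \<open>u\<close>.\<close>

definition agree_near :: "('m, 'n::finite) manifold \<Rightarrow> 'm \<Rightarrow> ('m \<Rightarrow> 'b) \<Rightarrow> ('m \<Rightarrow> 'b) \<Rightarrow> bool" where
  "agree_near M u f g \<longleftrightarrow> (\<exists>W. openin (space_of M) W \<and> u \<in> W \<and> (\<forall>w\<in>W. f w = g w))"


section \<open>Tangent vectors and vector fields\<close>

text \<open>A tangent vector at \<open>u\<close> is a derivation of the algebra of germs of smooth functions at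
  \<open>u\<close>.  As a total function it is \<open>0\<close> on functions that are not smooth near \<open>u\<close>, so that
  distinct total functions are distinct tangent vectors.\<close>

type_synonym 'm tangent_vector = "('m \<Rightarrow> real) \<Rightarrow> real"

definition tangent_space :: "('m, 'n::finite) manifold \<Rightarrow> 'm \<Rightarrow> 'm tangent_vector set" where
  "tangent_space M u = {v.
     (\<forall>f g. smooth_near M u f \<longrightarrow> smooth_near M u g \<longrightarrow> v (\<lambda>w. f w + g w) = v f + v g) \<and>
     (\<forall>c f. smooth_near M u f \<longrightarrow> v (\<lambda>w. c * f w) = c * v f) \<and>
     (\<forall>f g. smooth_near M u f \<longrightarrow> smooth_near M u g \<longrightarrow>
        v (\<lambda>w. f w * g w) = f u * v g + g u * v f) \<and>
     (\<forall>f g. smooth_near M u f \<longrightarrow> smooth_near M u g \<longrightarrow> agree_near M u f g \<longrightarrow> v f = v g) \<and>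
     (\<forall>f. \<not> smooth_near M u f \<longrightarrow> v f = 0)}"

text \<open>\<open>partial U x l f\<close> is the function \<open>\<partial>f/\<partial>x\<^sup>l\<close>
  on the chart domain \<open>U\<close>.\<close>

definition partial ::
    "'m set \<Rightarrow> ('m \<Rightarrow> real ^ 'n) \<Rightarrow> 'n \<Rightarrow> ('m \<Rightarrow> real) \<Rightarrow> 'm \<Rightarrow> real" where
  "partial U x l f u = frechet_derivative (f \<circ> inv_into U x) (at (x u)) (axis l 1)"

definition coord_vector ::
    "('m, 'n::finite) manifold \<Rightarrow> 'm set \<Rightarrow> ('m \<Rightarrow> real ^ 'n) \<Rightarrow> 'n \<Rightarrow> 'm \<Rightarrow> 'm tangent_vector" where
  "coord_vector M U x l u = (\<lambda>f. if smooth_near M u f then partial U x l f u else 0)"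

text \<open>The covector \<open>dx\<^sup>p\<close> on tangent vectors, \<open>dx\<^sup>p(v) = v(x\<^sup>p)\<close>.\<close>

definition coord_covector :: "('m \<Rightarrow> real ^ 'n) \<Rightarrow> 'n \<Rightarrow> 'm tangent_vector \<Rightarrow> real" where
  "coord_covector x p v = v (\<lambda>w. x w $ p)"

type_synonym 'm vector_field = "'m \<Rightarrow> 'm tangent_vector"

text \<open>\<open>vector_fields M W\<close> is \<open>\<chi>(W)\<close> for open \<open>W\<close>: sections of the tangent
  bundle over \<open>W\<close> whose components in every chart are smooth.  Outside \<open>W\<close> a field is
  set to \<open>0\<close> by convention.\<close>

definition vector_fields :: "('m, 'n::finite) manifold \<Rightarrow> 'm set \<Rightarrow> 'm vector_field set" where
  "vector_fields M W = {X.
     (\<forall>u\<in>W. X u \<in> tangent_space M u) \<and> (\<forall>u. u \<notin> W \<longrightarrow> X u = (\<lambda>_. 0)) \<and>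
     (\<forall>(U, x)\<in>atlas M. \<forall>p. smooth_fun M (U \<inter> W) (\<lambda>u. coord_covector x p (X u)))}"

definition act :: "'m vector_field \<Rightarrow> ('m \<Rightarrow> real) \<Rightarrow> 'm \<Rightarrow> real" where
  "act X f = (\<lambda>u. X u f)"

definition bracket ::
    "('m, 'n::finite) manifold \<Rightarrow> 'm vector_field \<Rightarrow> 'm vector_field \<Rightarrow> 'm vector_field" where
  "bracket M X Y = (\<lambda>u f. if smooth_near M u f then X u (act Y f) - Y u (act X f) else 0)"


section \<open>Tensors and the Leibniz coboundary\<close>

text \<open>A \<open>k\<close>-tensor assigns to each point \<open>u\<close> a \<open>k\<close>-linear form on the tangent
  space at \<open>u\<close>, given as a function on lists of \<open>k\<close> tangent vectors; as a section of the
  \<open>k\<close>-fold tensor power of the cotangent bundle it is smooth if its components in every chart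
  are smooth.\<close>

type_synonym 'm tensor_field = "'m \<Rightarrow> 'm tangent_vector list \<Rightarrow> real"

definition multilinear_form ::
    "nat \<Rightarrow> 'm tangent_vector set \<Rightarrow> ('m tangent_vector list \<Rightarrow> real) \<Rightarrow> bool" where
  "multilinear_form k V \<theta> \<longleftrightarrow>
     (\<forall>vs i a b v w. length vs = k \<and> set vs \<subseteq> V \<and> i < k \<and> v \<in> V \<and> w \<in> V \<longrightarrow>
        \<theta> (vs[i := (\<lambda>f. a * v f + b * w f)]) = a * \<theta> (vs[i := v]) + b * \<theta> (vs[i := w]))"

definition is_tensor :: "('m, 'n::finite) manifold \<Rightarrow> nat \<Rightarrow> 'm tensor_field \<Rightarrow> bool" where
  "is_tensor M k \<omega> \<longleftrightarrow>
     (\<forall>u\<in>points M. multilinear_form k (tangent_space M u) (\<omega> u)) \<and>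
     (\<forall>(U, x)\<in>atlas M. \<forall>ps. length ps = k \<longrightarrow>
        smooth_fun M U (\<lambda>u. \<omega> u (map (\<lambda>p. coord_vector M U x p u) ps)))"

text \<open>The map \<open>\<chi>(M)\<^sup>\<otimes>\<^sup>k \<rightarrow> C\<^sup>\<infinity>(M)\<close> determined by a
  tensor.  Linear maps on \<open>\<chi>(M)\<^sup>\<otimes>\<^sup>k\<close> are written as multilinear maps
  on lists of \<open>k\<close> vector fields.\<close>

definition tensor_map :: "'m tensor_field \<Rightarrow> 'm vector_field list \<Rightarrow> 'm \<Rightarrow> real" where
  "tensor_map \<omega> Xs u = \<omega> u (map (\<lambda>X. X u) Xs)"

definition omit :: "nat \<Rightarrow> 'a list \<Rightarrow> 'a list" where
  "omit i xs = take i xs @ drop (Suc i) xs"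

text \<open>List positions start at \<open>0\<close>, so the signs \<open>(-1)\<^sup>i\<^sup>+\<^sup>1\<close> and
  \<open>(-1)\<^sup>j\<^sup>+\<^sup>1\<close> of the formula indexed from \<open>1\<close> become
  \<open>(-1)\<^sup>i\<close> and \<open>(-1)\<^sup>j\<close>.\<close>

definition leibniz_coboundary ::
    "('m, 'n::finite) manifold \<Rightarrow> ('m vector_field list \<Rightarrow> 'm \<Rightarrow> real) \<Rightarrow>
     'm vector_field list \<Rightarrow> 'm \<Rightarrow> real" where
  "leibniz_coboundary M \<alpha> Xs u =
     (\<Sum>i<length Xs. (-1) ^ i * act (Xs ! i) (\<alpha> (omit i Xs)) u) +
     (\<Sum>j<length Xs. \<Sum>i<j. (-1) ^ j * \<alpha> (omit j (Xs[i := bracket M (Xs ! i) (Xs ! j)])) u)"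

text \<open>The value of \<open>d\<omega>\<close> at \<open>u\<close> on vector fields that are only defined on an open
  neighbourhood of \<open>u\<close>: replace them by global fields with the same germs at \<open>u\<close>.\<close>

definition local_coboundary ::
    "('m, 'n::finite) manifold \<Rightarrow> 'm tensor_field \<Rightarrow> 'm vector_field list \<Rightarrow> 'm \<Rightarrow> real" where
  "local_coboundary M \<omega> Xs u =
     (THE r. \<exists>Ys. list_all2 (\<lambda>X Y. Y \<in> vector_fields M (points M) \<and> agree_near M u X Y) Xs Ys \<and>
                  r = leibniz_coboundary M (tensor_map \<omega>) Ys u)"


section \<open>Operators from vector fields to functions\<close>

type_synonym 'm operator = "'m vector_field \<Rightarrow> 'm \<Rightarrow> real"

definition dx_op :: "('m \<Rightarrow> real ^ 'n) \<Rightarrow> 'n \<Rightarrow> 'm operator" where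
  "dx_op x p X = (\<lambda>u. coord_covector x p (X u))"

definition partial_dx_op :: "'m set \<Rightarrow> ('m \<Rightarrow> real ^ 'n) \<Rightarrow> 'n \<Rightarrow> 'n \<Rightarrow> 'm operator" where
  "partial_dx_op U x l p = partial U x l \<circ> dx_op x p"

definition tensor3 ::
    "'m operator \<Rightarrow> 'm operator \<Rightarrow> 'm operator \<Rightarrow> 'm vector_field list \<Rightarrow> 'm \<Rightarrow> real" where
  "tensor3 A B C Xs u = A (Xs ! 0) u * B (Xs ! 1) u * C (Xs ! 2) u"

end

theory Submission
  imports Defs
begin

text \<open>
  Both sides of the formula are expressions in the germs of the fields at \<open>u\<close>.  In a chart, write
  \<open>b\<close>, \<open>c\<close>, \<open>e\<close> for the components of \<open>X1\<close>, \<open>X2\<close>, \<open>X3\<close>.  The Leibniz rule turns the three terms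
  \<open>X\<^sub>i(\<omega>(X\<^sub>j, X\<^sub>k))\<close> into three terms containing a derivative of \<open>a\<^sub>p\<^sub>q\<close>, which are the first three sums of
  the formula, and six terms containing a derivative of a component.  The brackets
  \<open>[X, Y]\<^sup>p = X(Y\<^sup>p) - Y(X\<^sup>p)\<close> contribute six more terms of the latter kind.  Five pairs cancel;
  the two survivors are \<open>a\<^sub>p\<^sub>q c\<^sup>p X1(e\<^sup>q)\<close> and \<open>a\<^sub>p\<^sub>q c\<^sup>q X1(e\<^sup>p)\<close>, the last two sums.

  Tangent vectors being abstract derivations of germs, the identity \<open>v f = \<Sum>\<^sub>l v(x\<^sup>l) \<partial>f/\<partial>x\<^sup>l\<close>
  (\<open>tangent_vector_in_coordinates\<close>) has to come from Hadamard's lemma, whose coefficient functions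
  are integrals of partial derivatives along segments.  The same identity shows that \<open>X f\<close> is smooth
  when \<open>X\<close> and \<open>f\<close> are, so that brackets are again tangent vectors (\<open>bracket_tangent\<close>).

  The coboundary at \<open>u\<close> is defined through global fields with prescribed germs.  Such fields exist by
  multiplication with a bump function (\<open>vector_field_germ_extends\<close>), and their choice is immaterial
  because a derivation at \<open>u\<close> only sees germs (\<open>leibniz_coboundary_local\<close>).  Hence the local
  coboundary equals the defining expression evaluated on the given local fields
  (\<open>local_coboundary_eq\<close>), where the calculation above applies.
\<close>

section \<open>Higher differentiability on open sets\<close>

lemma higher_differentiable_on_cong:
  assumes "open S" "\<And>z. z \<in> S \<Longrightarrow> f z = g z"
  shows "higher_differentiable_on k S f = higher_differentiable_on k S g"
  using assms(2)
proof (induction k arbitrary: f g)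
  case 0
  then show ?case by (auto cong: continuous_on_cong)
next
  case (Suc k)
  have hd: "(f has_derivative D) (at z) \<longleftrightarrow> (g has_derivative D) (at z)" if "z \<in> S" for z D
    using has_derivative_transform_within_open[OF _ assms(1) that] Suc.prems by metis
  have fd: "frechet_derivative f (at z) = frechet_derivative g (at z)" if "z \<in> S" for z
    unfolding frechet_derivative_def using hd[OF that] by simp
  have "(\<forall>z\<in>S. f differentiable (at z)) = (\<forall>z\<in>S. g differentiable (at z))"
    using hd by (simp add: differentiable_def)
  moreover have "higher_differentiable_on k S (\<lambda>z. frechet_derivative f (at z) v) =
      higher_differentiable_on k S (\<lambda>z. frechet_derivative g (at z) v)" for v
    by (rule Suc.IH) (simp add: fd)
  ultimately show ?case by simp
qed

text \<open>Any explicit derivative \<open>D\<close> may be used in place of the Hilbert choice \<open>frechet_derivative\<close>: on an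
  open set the two agree.\<close>

lemma higher_differentiable_on_SucI:
  assumes "open S"
    and "\<And>z. z \<in> S \<Longrightarrow> (f has_derivative D z) (at z)"
    and "\<And>v. higher_differentiable_on k S (\<lambda>z. D z v)"
  shows "higher_differentiable_on (Suc k) S f"
proof -
  have "higher_differentiable_on k S (\<lambda>z. frechet_derivative f (at z) v)" for v
    using assms(3)[of v]
    by (subst higher_differentiable_on_cong[OF assms(1), of _ "\<lambda>z. D z v"])
      (auto simp: frechet_derivative_at[OF assms(2), symmetric])
  then show ?thesis using assms(2) by (auto simp: differentiable_def)
qed

lemma higher_differentiable_on_has_derivative:
  assumes "higher_differentiable_on (Suc k) S f" "z \<in> S"
  shows "(f has_derivative frechet_derivative f (at z)) (at z)"
  using assms by (simp add: frechet_derivative_works[symmetric])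

lemma higher_differentiable_on_SucD:
  "higher_differentiable_on (Suc k) S f \<Longrightarrow> higher_differentiable_on k S f"
proof (induction k arbitrary: f)
  case 0
  then have "\<forall>z\<in>S. f differentiable (at z)" by simp
  then show ?case
    by (auto intro!: continuous_at_imp_continuous_on differentiable_imp_continuous_within)
next
  case (Suc k)
  then have "\<forall>z\<in>S. f differentiable (at z)"
    and "\<And>v. higher_differentiable_on (Suc k) S (\<lambda>z. frechet_derivative f (at z) v)"
    using higher_differentiable_on.simps(2)[of "Suc k" S f] by blast+
  with Suc.IH show ?case using higher_differentiable_on.simps(2)[of k S f] by blast
qed

lemma higher_differentiable_on_subset:
  "higher_differentiable_on k S f \<Longrightarrow> T \<subseteq> S \<Longrightarrow> higher_differentiable_on k T f"
proof (induction k arbitrary: f)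
  case 0
  then show ?case using continuous_on_subset by auto
next
  case (Suc k)
  then show ?case by auto
qed

lemma higher_differentiable_on_local:
  assumes "\<And>z. z \<in> S \<Longrightarrow> \<exists>T. open T \<and> z \<in> T \<and> higher_differentiable_on k T f"
  shows "higher_differentiable_on k S f"
  using assms
proof (induction k arbitrary: f)
  case 0
  have "isCont f z" if z: "z \<in> S" for z
  proof -
    obtain T where "open T" "z \<in> T" "continuous_on T f" using 0[OF z] by auto
    then show ?thesis using continuous_on_eq_continuous_at by blast
  qed
  then show ?case by (simp add: continuous_at_imp_continuous_on)
next
  case (Suc k)
  have "f differentiable (at z)" if "z \<in> S" for z
    using Suc.prems[OF that] higher_differentiable_on.simps(2) by blast
  moreover have "higher_differentiable_on k S (\<lambda>z. frechet_derivative f (at z) v)" for v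
  proof (rule Suc.IH)
    fix z assume "z \<in> S"
    then obtain T where "open T" "z \<in> T" "higher_differentiable_on (Suc k) T f"
      using Suc.prems by blast
    then show "\<exists>T. open T \<and> z \<in> T \<and>
        higher_differentiable_on k T (\<lambda>z. frechet_derivative f (at z) v)"
      by auto
  qed
  ultimately show ?case by simp
qed

lemma higher_differentiable_on_const: "higher_differentiable_on k S (\<lambda>_. c)"
proof (induction k arbitrary: c)
  case (Suc k)
  then show ?case by (simp add: frechet_derivative_const)
qed simp

lemma higher_differentiable_on_bounded_linear:
  assumes "bounded_linear f" "open S"
  shows "higher_differentiable_on k S f"
proof (cases k)
  case 0
  then show ?thesis using assms linear_continuous_on by auto
next
  case (Suc j)
  have "higher_differentiable_on (Suc j) S f"
    by (rule higher_differentiable_on_SucI[where D = "\<lambda>_. f"])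
      (use assms in \<open>simp_all add: bounded_linear_imp_has_derivative higher_differentiable_on_const\<close>)
  then show ?thesis using Suc by simp
qed

lemma higher_differentiable_on_add:
  assumes "open S" "higher_differentiable_on k S f" "higher_differentiable_on k S g"
  shows "higher_differentiable_on k S (\<lambda>z. f z + g z)"
  using assms(2,3)
proof (induction k arbitrary: f g)
  case 0
  then show ?case by (auto intro: continuous_on_add)
next
  case (Suc k)
  show ?case
  proof (rule higher_differentiable_on_SucI[OF assms(1)])
    show "((\<lambda>z. f z + g z) has_derivative
        (\<lambda>v. frechet_derivative f (at z) v + frechet_derivative g (at z) v)) (at z)"
      if "z \<in> S" for z
      using that Suc.prems
      by (intro has_derivative_add higher_differentiable_on_has_derivative)
    show "higher_differentiable_on k S
        (\<lambda>z. frechet_derivative f (at z) v + frechet_derivative g (at z) v)" for v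
      using Suc by simp
  qed
qed

lemma higher_differentiable_on_sum:
  assumes "open S" "\<And>i. i \<in> I \<Longrightarrow> higher_differentiable_on k S (f i)"
  shows "higher_differentiable_on k S (\<lambda>z. \<Sum>i\<in>I. f i z)"
  using assms(2)
proof (induction I rule: infinite_finite_induct)
  case (insert i I)
  then show ?case by (simp add: higher_differentiable_on_add[OF assms(1)])
qed (simp_all add: higher_differentiable_on_const)

lemma higher_differentiable_on_bilinear:
  assumes "bounded_bilinear h" "open S"
    and "higher_differentiable_on k S f" "higher_differentiable_on k S g"
  shows "higher_differentiable_on k S (\<lambda>z. h (f z) (g z))"
  using assms(3,4)
proof (induction k arbitrary: f g)
  case 0
  then show ?case by (auto intro: bounded_bilinear.continuous_on[OF assms(1)])
next
  case (Suc k)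
  show ?case
  proof (rule higher_differentiable_on_SucI[OF assms(2)])
    show "((\<lambda>z. h (f z) (g z)) has_derivative
        (\<lambda>v. h (f z) (frechet_derivative g (at z) v) + h (frechet_derivative f (at z) v) (g z)))
        (at z)" if "z \<in> S" for z
      using that Suc.prems
      by (intro bounded_bilinear.FDERIV[OF assms(1)] higher_differentiable_on_has_derivative)
    show "higher_differentiable_on k S
        (\<lambda>z. h (f z) (frechet_derivative g (at z) v) + h (frechet_derivative f (at z) v) (g z))"
      for v
      using Suc.prems higher_differentiable_on_SucD[of k S f] higher_differentiable_on_SucD[of k S g]
      by (intro higher_differentiable_on_add[OF assms(2)] Suc.IH) auto
  qed
qed

text \<open>By the chain rule, \<open>D(g \<circ> f)(z) v = \<Sum>\<^sub>i (Df(z) v)\<^sub>i \<partial>\<^sub>ig(f z)\<close>: expanding the inner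
  derivative in a basis turns the derivative of a composite into a sum of products to which the
  induction hypothesis applies.\<close>

lemma higher_differentiable_on_compose:
  fixes f :: "'a::real_normed_vector \<Rightarrow> 'b::euclidean_space" and g :: "'b \<Rightarrow> 'c::real_normed_vector"
  assumes "open S" "open T" "f ` S \<subseteq> T"
    and "higher_differentiable_on k S f" "higher_differentiable_on k T g"
  shows "higher_differentiable_on k S (\<lambda>z. g (f z))"
  using assms(4,5)
proof (induction k arbitrary: g)
  case 0
  then have "continuous_on T g" "continuous_on S f" by simp_all
  then show ?case using continuous_on_compose2 assms(3) unfolding higher_differentiable_on.simps
    by blast
next
  case (Suc k)
  let ?Df = "\<lambda>z. frechet_derivative f (at z)" and ?Dg = "\<lambda>y. frechet_derivative g (at y)"
  have f: "higher_differentiable_on k S f" and Df: "\<And>v. higher_differentiable_on k S (\<lambda>z. ?Df z v)"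
    using higher_differentiable_on_SucD[OF Suc.prems(1)] Suc.prems(1) by auto
  have Dgf: "higher_differentiable_on k S (\<lambda>z. ?Dg (f z) i)" for i
    by (rule Suc.IH[OF f]) (use Suc.prems(2) in simp)
  have der: "((\<lambda>z. g (f z)) has_derivative (\<lambda>v. ?Dg (f z) (?Df z v))) (at z)" if "z \<in> S" for z
  proof -
    have "f z \<in> T" using that assms(3) by auto
    from diff_chain_at[OF higher_differentiable_on_has_derivative[OF Suc.prems(1) that]
        higher_differentiable_on_has_derivative[OF Suc.prems(2) this]]
    show ?thesis by (simp only: o_def)
  qed
  show ?case
  proof (rule higher_differentiable_on_SucI[OF assms(1)])
    show "((\<lambda>z. g (f z)) has_derivative (\<lambda>v. \<Sum>i\<in>Basis. (?Df z v \<bullet> i) *\<^sub>R ?Dg (f z) i)) (at z)"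
      if z: "z \<in> S" for z
    proof -
      have lin: "linear (?Dg (f z))"
        using z assms(3) Suc.prems(2) by (intro linear_frechet_derivative) (simp add: image_subset_iff)
      have "?Dg (f z) w = (\<Sum>i\<in>Basis. (w \<bullet> i) *\<^sub>R ?Dg (f z) i)" for w
        using linear_sum[OF lin, of "\<lambda>i. (w \<bullet> i) *\<^sub>R i" Basis]
        unfolding euclidean_representation linear_scale[OF lin] .
      then have "(\<lambda>v. ?Dg (f z) (?Df z v)) = (\<lambda>v. \<Sum>i\<in>Basis. (?Df z v \<bullet> i) *\<^sub>R ?Dg (f z) i)"
        by (intro ext)
      from subst[OF this, of "\<lambda>D. ((\<lambda>z. g (f z)) has_derivative D) (at z)", OF der[OF z]]
      show ?thesis .
    qed
    show "higher_differentiable_on k S (\<lambda>z. \<Sum>i\<in>Basis. (?Df z v \<bullet> i) *\<^sub>R ?Dg (f z) i)" for v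
      by (intro higher_differentiable_on_sum assms(1) Dgf Df higher_differentiable_on_const
          higher_differentiable_on_bilinear[OF bounded_bilinear_scaleR]
          higher_differentiable_on_bilinear[OF bounded_bilinear_inner])
  qed
qed

text \<open>The derivative \<open>-1/z\<^sup>2\<close> is a product of two inverses, so closure under products drives the
  induction.\<close>

lemma higher_differentiable_on_inverse:
  fixes S :: "real set"
  assumes "open S" "0 \<notin> S"
  shows "higher_differentiable_on k S inverse"
proof (induction k)
  case 0
  then show ?case using assms by (auto intro!: continuous_intros)
next
  case (Suc k)
  show ?case
  proof (rule higher_differentiable_on_SucI[OF assms(1)])
    show "(inverse has_derivative (\<lambda>v. (- v) * (inverse z * inverse z))) (at z)" if "z \<in> S" for z
      using that assms(2) by (auto intro!: derivative_eq_intros)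
    show "higher_differentiable_on k S (\<lambda>z. (- v) * (inverse z * inverse z))" for v
      by (intro higher_differentiable_on_bilinear[OF bounded_bilinear_mult] assms(1) Suc
          higher_differentiable_on_const)
  qed
qed

lemma higher_differentiable_on_imp_continuous_on:
  "higher_differentiable_on k S f \<Longrightarrow> continuous_on S f"
proof (induction k arbitrary: f)
  case (Suc k)
  then show ?case using higher_differentiable_on_SucD[OF Suc.prems] by blast
qed simp

lemma smooth_on_cong:
  "open S \<Longrightarrow> (\<And>z. z \<in> S \<Longrightarrow> f z = g z) \<Longrightarrow> smooth_on S f = smooth_on S g"
  unfolding smooth_on_def using higher_differentiable_on_cong by blast

lemma smooth_on_subset: "smooth_on S f \<Longrightarrow> T \<subseteq> S \<Longrightarrow> smooth_on T f"
  unfolding smooth_on_def using higher_differentiable_on_subset by blast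

lemma smooth_on_local:
  assumes "\<And>z. z \<in> S \<Longrightarrow> \<exists>T. open T \<and> z \<in> T \<and> smooth_on T f"
  shows "smooth_on S f"
  unfolding smooth_on_def
proof
  fix k
  show "higher_differentiable_on k S f"
    by (rule higher_differentiable_on_local) (use assms in \<open>auto simp only: smooth_on_def\<close>)
qed

lemma smooth_on_const: "smooth_on S (\<lambda>_. c)"
  unfolding smooth_on_def using higher_differentiable_on_const by blast

lemma smooth_on_add:
  "open S \<Longrightarrow> smooth_on S f \<Longrightarrow> smooth_on S g \<Longrightarrow> smooth_on S (\<lambda>z. f z + g z)"
  unfolding smooth_on_def using higher_differentiable_on_add by blast

lemma smooth_on_bilinear:
  "bounded_bilinear h \<Longrightarrow> open S \<Longrightarrow> smooth_on S f \<Longrightarrow> smooth_on S g \<Longrightarrow> smooth_on S (\<lambda>z. h (f z) (g z))"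
  unfolding smooth_on_def using higher_differentiable_on_bilinear by blast

lemmas smooth_on_mult = smooth_on_bilinear[OF bounded_bilinear_mult]

lemma smooth_on_bounded_linear: "bounded_linear f \<Longrightarrow> open S \<Longrightarrow> smooth_on S f"
  unfolding smooth_on_def using higher_differentiable_on_bounded_linear by blast

lemma smooth_on_compose:
  fixes f :: "'a::real_normed_vector \<Rightarrow> 'b::euclidean_space" and g :: "'b \<Rightarrow> 'c::real_normed_vector"
  shows "open S \<Longrightarrow> open T \<Longrightarrow> f ` S \<subseteq> T \<Longrightarrow> smooth_on S f \<Longrightarrow> smooth_on T g \<Longrightarrow>
    smooth_on S (\<lambda>z. g (f z))"
  unfolding smooth_on_def using higher_differentiable_on_compose[of S T f _ g] by blast

lemma smooth_on_frechet_derivative: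
  assumes "smooth_on S f"
  shows "smooth_on S (\<lambda>z. frechet_derivative f (at z) v)"
  unfolding smooth_on_def
proof
  fix k
  have "higher_differentiable_on (Suc k) S f" using assms smooth_on_def by blast
  then show "higher_differentiable_on k S (\<lambda>z. frechet_derivative f (at z) v)" by simp
qed

lemma smooth_on_has_derivative:
  assumes "smooth_on S f" "z \<in> S"
  shows "(f has_derivative frechet_derivative f (at z)) (at z)"
proof -
  have "higher_differentiable_on (Suc 0) S f" using assms smooth_on_def by blast
  from higher_differentiable_on_has_derivative[OF this assms(2)] show ?thesis .
qed

lemma smooth_on_imp_continuous_on: "smooth_on S f \<Longrightarrow> continuous_on S f"
  unfolding smooth_on_def using higher_differentiable_on_imp_continuous_on by blast


section \<open>Hadamard's lemma\<close>

text \<open>Differentiation under the integral sign replaces the weight \<open>\<phi>(t)\<close> by \<open>t \<phi>(t)\<close> and \<open>G\<close> by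
  one of its directional derivatives.  An arbitrary weight \<open>\<phi>\<close> therefore makes the statement
  inductive.\<close>

lemma higher_differentiable_on_segment_integral:
  fixes G :: "'a::euclidean_space \<Rightarrow> real" and \<phi> :: "real \<Rightarrow> real"
  assumes "open S" "convex S" "c \<in> S"
    and "continuous_on {0..1} \<phi>" "higher_differentiable_on k S G"
  shows "higher_differentiable_on k S (\<lambda>y. integral {0..1} (\<lambda>t. \<phi> t * G (c + t *\<^sub>R (y - c))))"
proof -
  have in_S: "c + t *\<^sub>R (y - c) \<in> S" if "y \<in> S" "t \<in> {0..1}" for y t
  proof -
    have "(1 - t) *\<^sub>R c + t *\<^sub>R y \<in> S"
      using convexD_alt[OF assms(2,3) that(1)] that(2) by simp
    then show ?thesis by (simp add: algebra_simps)
  qed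
  have cont: "continuous_on (S \<times> cbox 0 1) (\<lambda>(y, t). \<psi> t * H (c + t *\<^sub>R (y - c)))"
    if "continuous_on {0..1} \<psi>" "continuous_on S H" for H and \<psi> :: "real \<Rightarrow> real"
  proof -
    have "continuous_on (S \<times> {0..1}) (\<lambda>p. H (c + snd p *\<^sub>R (fst p - c)))"
      by (rule continuous_on_compose2[OF that(2)]) (use in_S in \<open>auto intro!: continuous_intros\<close>)
    moreover have "continuous_on (S \<times> {0..1}) (\<lambda>p. \<psi> (snd p))"
      by (rule continuous_on_compose2[OF that(1)]) (auto intro!: continuous_intros)
    ultimately show ?thesis
      by (simp add: split_beta continuous_on_mult)
  qed
  have slice: "(\<lambda>t. \<psi> t * H (c + t *\<^sub>R (y - c))) integrable_on {0..1}"
    if "continuous_on {0..1} \<psi>" "continuous_on S H" "y \<in> S" for H y and \<psi> :: "real \<Rightarrow> real"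
  proof (rule integrable_continuous_real)
    have "continuous_on {0..1} (\<lambda>t. (\<lambda>(y, t). \<psi> t * H (c + t *\<^sub>R (y - c))) (y, t))"
      by (rule continuous_on_compose2[OF cont[OF that(1,2)]])
        (use that(3) in \<open>auto intro!: continuous_intros\<close>)
    then show "continuous_on {0..1} (\<lambda>t. \<psi> t * H (c + t *\<^sub>R (y - c)))" by simp
  qed
  from assms(4,5) show ?thesis
  proof (induction k arbitrary: \<phi> G)
    case 0
    then have "continuous_on S G" by simp
    from integral_continuous_on_param[OF cont[OF 0(1) this]] show ?case by simp
  next
    case (Suc k)
    let ?DG = "\<lambda>z. frechet_derivative G (at z)"
    let ?DF = "\<lambda>y v. integral {0..1} (\<lambda>t. (\<phi> t * t) * ?DG (c + t *\<^sub>R (y - c)) v)"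
    define D where "D y t = (\<phi> t * t) *\<^sub>R Blinfun (?DG (c + t *\<^sub>R (y - c)))" for y t
    have der: "(G has_derivative ?DG z) (at z)" if "z \<in> S" for z
      using higher_differentiable_on_has_derivative[OF Suc.prems(2) that] .
    have app: "blinfun_apply (D y t) v = (\<phi> t * t) * ?DG (c + t *\<^sub>R (y - c)) v"
      if "y \<in> S" "t \<in> {0..1}" for y t v
      using der[OF in_S[OF that]]
      by (simp add: D_def scaleR_blinfun.rep_eq bounded_linear_Blinfun_apply has_derivative_bounded_linear)
    have DG_hd: "higher_differentiable_on k S (\<lambda>z. ?DG z v)" for v
      using Suc.prems(2) by simp
    note DG_cont = higher_differentiable_on_imp_continuous_on[OF DG_hd]
    have \<phi>': "continuous_on {0..1} (\<lambda>t. \<phi> t * t)"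
      by (intro continuous_intros Suc.prems)
    have D_cont: "continuous_on (S \<times> cbox 0 1) (\<lambda>(y, t). D y t)"
    proof (rule continuous_on_blinfun_componentwise)
      fix i :: 'a
      show "continuous_on (S \<times> cbox 0 1) (\<lambda>p. blinfun_apply ((\<lambda>(y, t). D y t) p) i)"
        by (rule continuous_on_eq[OF cont[OF \<phi>' DG_cont[of i]]]) (auto simp: app)
    qed
    show ?case
    proof (rule higher_differentiable_on_SucI[OF assms(1), where D = ?DF])
      fix y assume y: "y \<in> S"
      have "((\<lambda>y. integral (cbox 0 1) (\<lambda>t. \<phi> t * G (c + t *\<^sub>R (y - c)))) has_derivative
          blinfun_apply (integral (cbox 0 1) (D y))) (at y within S)"
      proof (rule leibniz_rule[OF _ _ D_cont y assms(2)])
        fix y t assume yt: "y \<in> S" "t \<in> cbox (0::real) 1"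
        then have "c + t *\<^sub>R (y - c) \<in> S" using in_S by simp
        note dG = der[OF this]
        have lin: "?DG (c + t *\<^sub>R (y - c)) (t *\<^sub>R v) = t * ?DG (c + t *\<^sub>R (y - c)) v" for v
          using linear_scale[OF has_derivative_linear[OF dG]] by simp
        have "((\<lambda>y. c + t *\<^sub>R (y - c)) has_derivative (\<lambda>v. t *\<^sub>R v)) (at y)"
          by (auto intro!: derivative_eq_intros)
        from has_derivative_mult_right[OF has_derivative_compose[OF this dG], of "\<phi> t"]
        have "((\<lambda>y. \<phi> t * G (c + t *\<^sub>R (y - c))) has_derivative
            (\<lambda>v. \<phi> t * t * ?DG (c + t *\<^sub>R (y - c)) v)) (at y)"
          unfolding lin by (simp only: mult.assoc)
        moreover have "blinfun_apply (D y t) = (\<lambda>v. \<phi> t * t * ?DG (c + t *\<^sub>R (y - c)) v)"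
          using app yt by auto
        ultimately show "((\<lambda>y. \<phi> t * G (c + t *\<^sub>R (y - c))) has_derivative blinfun_apply (D y t))
            (at y within S)"
          by (simp add: has_derivative_at_withinI)
      next
        fix y assume "y \<in> S"
        show "(\<lambda>t. \<phi> t * G (c + t *\<^sub>R (y - c))) integrable_on cbox 0 1"
          using slice[OF Suc.prems(1) higher_differentiable_on_imp_continuous_on[OF Suc.prems(2)] \<open>y \<in> S\<close>]
          by simp
      qed
      moreover have "blinfun_apply (integral (cbox 0 1) (D y)) = ?DF y"
      proof
        fix v
        have "continuous_on {0..1} (\<lambda>t. (\<lambda>(y, t). D y t) (y, t))"
          by (rule continuous_on_compose2[OF D_cont]) (use y in \<open>auto intro!: continuous_intros\<close>)
        then have "D y integrable_on {0..1}"
          by (intro integrable_continuous_real) simp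
        then have "blinfun_apply (integral {0..1} (D y)) v = integral {0..1} (\<lambda>t. blinfun_apply (D y t) v)"
          by (rule blinfun_apply_integral)
        also have "\<dots> = ?DF y v"
          by (rule integral_cong) (simp add: app y)
        finally show "blinfun_apply (integral (cbox 0 1) (D y)) v = ?DF y v" by simp
      qed
      ultimately show "((\<lambda>y. integral {0..1} (\<lambda>t. \<phi> t * G (c + t *\<^sub>R (y - c)))) has_derivative ?DF y) (at y)"
        using at_within_open[OF y assms(1)] by simp
    next
      fix v
      show "higher_differentiable_on k S (\<lambda>y. ?DF y v)"
        by (rule Suc.IH[OF \<phi>' DG_hd])
    qed
  qed
qed

text \<open>Integrating the derivative of \<open>f\<close> along the segment from \<open>c\<close> to \<open>y\<close> gives
  \<open>f(y) - f(c) = \<Sum>\<^sub>i (y - c)\<^sub>i \<integral>\<^sub>0\<^sup>1 \<partial>\<^sub>if(c + t(y - c)) dt\<close>.\<close>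

lemma hadamard:
  fixes f :: "'a::euclidean_space \<Rightarrow> real"
  assumes "open S" "convex S" "c \<in> S" "smooth_on S f"
  obtains g where "\<And>i. smooth_on S (g i)"
    and "\<And>i. g i c = frechet_derivative f (at c) i"
    and "\<And>y. y \<in> S \<Longrightarrow> f y = f c + (\<Sum>i\<in>Basis. ((y - c) \<bullet> i) * g i y)"
proof
  let ?Df = "\<lambda>z. frechet_derivative f (at z)"
  define g where "g i y = integral {0..1} (\<lambda>t. 1 * ?Df (c + t *\<^sub>R (y - c)) i)" for i y
  show "smooth_on S (g i)" for i
    unfolding smooth_on_def
  proof
    fix k
    have "higher_differentiable_on k S (\<lambda>z. ?Df z i)"
      using smooth_on_frechet_derivative[OF assms(4)] smooth_on_def by blast
    from higher_differentiable_on_segment_integral[OF assms(1-3) continuous_on_const this]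
    show "higher_differentiable_on k S (g i)"
      unfolding g_def .
  qed
  show "g i c = ?Df c i" for i
    by (simp add: g_def)
  fix y assume y: "y \<in> S"
  have in_S: "c + t *\<^sub>R (y - c) \<in> S" if "t \<in> {0..1}" for t
  proof -
    have "(1 - t) *\<^sub>R c + t *\<^sub>R y \<in> S"
      using convexD_alt[OF assms(2,3) y] that by simp
    then show ?thesis by (simp add: algebra_simps)
  qed
  have int: "(\<lambda>t. ?Df (c + t *\<^sub>R (y - c)) i) integrable_on {0..1}" for i
    by (intro integrable_continuous_real
        continuous_on_compose2[OF smooth_on_imp_continuous_on[OF smooth_on_frechet_derivative[OF assms(4)]]])
      (use in_S in \<open>auto intro!: continuous_intros\<close>)
  have expand: "?Df z (y - c) = (\<Sum>i\<in>Basis. ((y - c) \<bullet> i) * ?Df z i)" if "z \<in> S" for z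
  proof -
    have lin: "linear (?Df z)"
      using has_derivative_linear[OF smooth_on_has_derivative[OF assms(4) that]] .
    show ?thesis
      using linear_sum[OF lin, of "\<lambda>i. ((y - c) \<bullet> i) *\<^sub>R i" Basis]
      unfolding euclidean_representation linear_scale[OF lin] real_scaleR_def .
  qed
  have "((\<lambda>t. ?Df (c + t *\<^sub>R (y - c)) (y - c)) has_integral
      (f (c + 1 *\<^sub>R (y - c)) - f (c + 0 *\<^sub>R (y - c)))) {0..1}"
  proof (rule fundamental_theorem_of_calculus)
    fix t :: real assume "t \<in> {0..1}"
    note df = smooth_on_has_derivative[OF assms(4) in_S[OF this]]
    have "((\<lambda>t. c + t *\<^sub>R (y - c)) has_derivative (\<lambda>s. s *\<^sub>R (y - c))) (at t within {0..1})"
      by (auto intro!: derivative_eq_intros)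
    from has_derivative_compose[OF this df]
    show "((\<lambda>t. f (c + t *\<^sub>R (y - c))) has_vector_derivative ?Df (c + t *\<^sub>R (y - c)) (y - c))
        (at t within {0..1})"
      unfolding has_vector_derivative_def linear_scale[OF has_derivative_linear[OF df]] .
  qed simp
  then have "f y - f c = integral {0..1} (\<lambda>t. ?Df (c + t *\<^sub>R (y - c)) (y - c))"
    by (simp add: integral_unique)
  also have "\<dots> = integral {0..1} (\<lambda>t. \<Sum>i\<in>Basis. ((y - c) \<bullet> i) * ?Df (c + t *\<^sub>R (y - c)) i)"
    by (rule integral_cong) (rule expand[OF in_S])
  also have "\<dots> = (\<Sum>i\<in>Basis. integral {0..1} (\<lambda>t. ((y - c) \<bullet> i) * ?Df (c + t *\<^sub>R (y - c)) i))"
    by (intro integral_sum integrable_on_mult_right int) simp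
  also have "\<dots> = (\<Sum>i\<in>Basis. ((y - c) \<bullet> i) * g i y)"
    by (simp add: g_def)
  finally show "f y = f c + (\<Sum>i\<in>Basis. ((y - c) \<bullet> i) * g i y)" by simp
qed


section \<open>Smooth bump functions\<close>

text \<open>The family of functions \<open>p(1/t) e\<^bsup>-1/t\<^esup>\<close>, extended by \<open>0\<close>.  The polynomial factor makes it closed
  under differentiation; the classical flat function is the case \<open>p = 1\<close>.\<close>

definition flat_exp :: "real poly \<Rightarrow> real \<Rightarrow> real" where
  "flat_exp p t = (if t \<le> 0 then 0 else poly p (inverse t) * exp (- inverse t))"

lemma poly_div_exp_tendsto_0: "((\<lambda>s. poly p s / exp s) \<longlongrightarrow> (0::real)) at_top"
proof -
  have "((\<lambda>s. \<Sum>i\<le>degree p. coeff p i * (s ^ i / exp s)) \<longlongrightarrow> (\<Sum>i\<le>degree p. coeff p i * 0)) at_top"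
    by (intro tendsto_sum tendsto_mult tendsto_const tendsto_power_div_exp_0)
  then show ?thesis
    by (simp add: poly_altdef sum_divide_distrib)
qed

text \<open>The derivative of \<open>p(1/t) e\<^bsup>-1/t\<^esup>\<close> is again of this form, with \<open>s\<^sup>2 (p(s) - p'(s))\<close> for \<open>p(s)\<close>,
  and at \<open>0\<close> it vanishes because \<open>e\<^sup>-\<^sup>s\<close> decays faster than any polynomial grows.\<close>

lemma has_field_derivative_flat_exp:
  "(flat_exp p has_field_derivative flat_exp ([:0, 0, 1:] * (p - pderiv p)) z) (at z)"
proof -
  consider "z < 0" | "z = 0" | "z > 0" by linarith
  then show ?thesis
  proof cases
    case 1
    have "((\<lambda>_. 0) has_field_derivative 0) (at z)" by simp
    then show ?thesis
      by (rule DERIV_cong[OF has_field_derivative_transform_within_open[where S = "{..<0}"]])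
        (use 1 in \<open>auto simp: flat_exp_def\<close>)
  next
    case 2
    have "((\<lambda>y. (flat_exp p y - flat_exp p 0) / (y - 0)) \<longlongrightarrow> 0) (at_right 0)"
    proof -
      have "((\<lambda>y. poly ([:0, 1:] * p) (inverse y) / exp (inverse y)) \<longlongrightarrow> (0::real)) (at_right 0)"
        using filterlim_compose[OF poly_div_exp_tendsto_0 filterlim_inverse_at_top_right] .
      then show ?thesis
        by (rule Lim_transform_eventually)
          (auto simp: flat_exp_def exp_minus divide_simps eventually_at_filter)
    qed
    moreover have "((\<lambda>y. (flat_exp p y - flat_exp p 0) / (y - 0)) \<longlongrightarrow> 0) (at_left 0)"
      by (rule Lim_transform_eventually[OF tendsto_const])
        (auto simp: flat_exp_def eventually_at_filter)
    ultimately show ?thesis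
      unfolding 2 has_field_derivative_iff by (simp add: flat_exp_def filterlim_split_at)
  next
    case 3
    have "((\<lambda>t. poly p (inverse t) * exp (- inverse t)) has_field_derivative
        poly ([:0, 0, 1:] * (p - pderiv p)) (inverse z) * exp (- inverse z)) (at z)"
      using 3 by (auto intro!: derivative_eq_intros DERIV_chain2[OF poly_DERIV]
          simp: algebra_simps power2_eq_square)
    then have "(flat_exp p has_field_derivative
        poly ([:0, 0, 1:] * (p - pderiv p)) (inverse z) * exp (- inverse z)) (at z)"
      by (rule has_field_derivative_transform_within_open[where S = "{0<..}"])
        (use 3 in \<open>auto simp: flat_exp_def\<close>)
    then show ?thesis using 3 by (simp add: flat_exp_def)
  qed
qed

lemma smooth_on_flat_exp: "smooth_on UNIV (flat_exp p)"
proof -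
  have "higher_differentiable_on k UNIV (flat_exp p)" for k
  proof (induction k arbitrary: p)
    case 0
    have "isCont (flat_exp p) z" for z
      using DERIV_isCont[OF has_field_derivative_flat_exp] .
    then show ?case by (simp add: continuous_at_imp_continuous_on)
  next
    case (Suc k)
    show ?case
    proof (rule higher_differentiable_on_SucI[OF open_UNIV])
      show "(flat_exp p has_derivative (\<lambda>v. flat_exp ([:0, 0, 1:] * (p - pderiv p)) z * v)) (at z)"
        for z
        using has_field_derivative_flat_exp[of p z] unfolding has_field_derivative_def .
      show "higher_differentiable_on k UNIV (\<lambda>z. flat_exp ([:0, 0, 1:] * (p - pderiv p)) z * v)" for v
        by (intro higher_differentiable_on_bilinear[OF bounded_bilinear_mult] open_UNIV Suc
            higher_differentiable_on_const)
    qed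
  qed
  then show ?thesis by (simp add: smooth_on_def)
qed

text \<open>With \<open>A\<close> positive exactly inside radius \<open>r\<close> and \<open>B\<close> positive exactly outside radius \<open>r/2\<close>, the
  quotient \<open>A / (A + B)\<close> has nonzero denominator everywhere and the required plateaus.  Squared
  distances keep the arguments smooth at the centre.\<close>

lemma smooth_bump:
  fixes c :: "'a::euclidean_space"
  assumes "r > 0"
  obtains h :: "'a \<Rightarrow> real" where "smooth_on UNIV h"
    and "\<And>y. dist c y \<le> r / 2 \<Longrightarrow> h y = 1" and "\<And>y. dist c y \<ge> r \<Longrightarrow> h y = 0"
proof
  define s where "s y = (y - c) \<bullet> (y - c)" for y
  define A where "A y = flat_exp 1 (r\<^sup>2 + (- 1) * s y)" for y
  define B where "B y = flat_exp 1 (s y + (- (r / 2)\<^sup>2))" for y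
  have s: "s y = (dist c y)\<^sup>2" for y
    by (subst dist_commute) (simp add: s_def dist_norm power2_norm_eq_inner)
  have nonneg: "A y \<ge> 0" "B y \<ge> 0" for y
    by (simp_all add: A_def B_def flat_exp_def)
  have A0: "A y = 0 \<longleftrightarrow> r \<le> dist c y" for y
    using assms by (auto simp: A_def flat_exp_def s power2_le_iff_abs_le)
  have B0: "B y = 0 \<longleftrightarrow> dist c y \<le> r / 2" for y
    using assms by (auto simp: B_def flat_exp_def s power2_le_iff_abs_le abs_le_square_iff[symmetric])
  have pos: "A y + B y > 0" for y
  proof -
    have "A y \<noteq> 0 \<or> B y \<noteq> 0" unfolding A0 B0 using assms by linarith
    then show ?thesis using nonneg[of y] by linarith
  qed
  have id: "smooth_on UNIV (\<lambda>y::'a. y)"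
    by (rule smooth_on_bounded_linear) (simp_all add: bounded_linear_ident)
  have "smooth_on UNIV (\<lambda>y. (y + (- c)) \<bullet> (y + (- c)))"
    by (intro smooth_on_bilinear[OF bounded_bilinear_inner] smooth_on_add open_UNIV id smooth_on_const)
  then have s_smooth: "smooth_on UNIV s" by (simp add: s_def[abs_def])
  have A_smooth: "smooth_on UNIV A" unfolding A_def
    by (rule smooth_on_compose[OF open_UNIV open_UNIV _ _ smooth_on_flat_exp, simplified])
      (intro smooth_on_add smooth_on_mult smooth_on_const open_UNIV s_smooth)
  have B_smooth: "smooth_on UNIV B" unfolding B_def
    by (rule smooth_on_compose[OF open_UNIV open_UNIV _ _ smooth_on_flat_exp, simplified])
      (intro smooth_on_add smooth_on_const open_UNIV s_smooth)
  have "smooth_on {0<..} (inverse :: real \<Rightarrow> real)"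
    by (simp add: smooth_on_def higher_differentiable_on_inverse)
  from smooth_on_compose[OF open_UNIV open_greaterThan _ smooth_on_add[OF open_UNIV A_smooth B_smooth] this]
  have "smooth_on UNIV (\<lambda>y. inverse (A y + B y))" using pos by auto
  from smooth_on_mult[OF open_UNIV A_smooth this]
  show "smooth_on UNIV (\<lambda>y. A y * inverse (A y + B y))" .
  show "A y * inverse (A y + B y) = 1" if "dist c y \<le> r / 2" for y
    using that pos[of y] B0[of y] by simp
  show "A y * inverse (A y + B y) = 0" if "dist c y \<ge> r" for y
    using that A0[of y] by simp
qed


section \<open>Smooth functions on a manifold\<close>

locale smooth_mfd =
  fixes M :: "('m, 'n::finite) manifold"
  assumes smooth_manifold: "smooth_manifold M"
begin

lemma chart_topological: "(U, x) \<in> atlas M \<Longrightarrow> topological_chart (space_of M) U x"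
  using smooth_manifold unfolding smooth_manifold_def by blast

lemma chart_openin: "(U, x) \<in> atlas M \<Longrightarrow> openin (space_of M) U"
  using chart_topological unfolding topological_chart_def by blast

lemma chart_subset_points: "(U, x) \<in> atlas M \<Longrightarrow> U \<subseteq> points M"
  using chart_openin openin_subset by blast

lemma chart_at:
  assumes "u \<in> points M"
  obtains U x where "(U, x) \<in> atlas M" "u \<in> U"
  using assms smooth_manifold unfolding smooth_manifold_def by blast

lemma chart_homeomorphic_map:
  "(U, x) \<in> atlas M \<Longrightarrow> homeomorphic_map (subtopology (space_of M) U) (top_of_set (x ` U)) x"
  using chart_topological unfolding topological_chart_def by blast

lemma chart_inj_on: "(U, x) \<in> atlas M \<Longrightarrow> inj_on x U"
  using homeomorphic_imp_injective_map[OF chart_homeomorphic_map] chart_subset_points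
  by (metis inf.absorb_iff2 topspace_subtopology)

lemma chart_inverse: "(U, x) \<in> atlas M \<Longrightarrow> w \<in> U \<Longrightarrow> inv_into U x (x w) = w"
  using chart_inj_on inv_into_f_f by fastforce

lemma chart_open_image:
  assumes "(U, x) \<in> atlas M" "openin (space_of M) W" "W \<subseteq> U"
  shows "open (x ` W)"
proof -
  have "openin (subtopology (space_of M) U) W"
    using assms(2,3) by (metis inf.absorb_iff1 openin_subtopology_Int)
  then have "openin (top_of_set (x ` U)) (x ` W)"
    using homeomorphic_imp_open_map[OF chart_homeomorphic_map[OF assms(1)]] open_map_def by blast
  moreover have "open (x ` U)"
    using chart_topological[OF assms(1)] unfolding topological_chart_def by blast
  ultimately show ?thesis using openin_open_trans by blast
qed

lemma chart_openin_preimage: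
  assumes "(U, x) \<in> atlas M" "open B"
  shows "openin (space_of M) {w \<in> U. x w \<in> B}"
proof -
  have "continuous_map (subtopology (space_of M) U) (top_of_set (x ` U)) x"
    using homeomorphic_imp_continuous_map[OF chart_homeomorphic_map[OF assms(1)]] .
  moreover have "openin (top_of_set (x ` U)) (x ` U \<inter> B)"
    using assms(2) by (simp add: openin_open_Int)
  ultimately have "openin (subtopology (space_of M) U)
      {w \<in> topspace (subtopology (space_of M) U). x w \<in> x ` U \<inter> B}"
    using openin_continuous_map_preimage by blast
  moreover have "{w \<in> topspace (subtopology (space_of M) U). x w \<in> x ` U \<inter> B} = {w \<in> U. x w \<in> B}"
    using chart_subset_points[OF assms(1)] by (auto simp: topspace_subtopology)
  ultimately show ?thesis using openin_trans_full chart_openin[OF assms(1)] by metis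
qed

lemma chart_transition_smooth:
  assumes "(U, x) \<in> atlas M" "(V, y) \<in> atlas M"
  shows "smooth_on (y ` (V \<inter> U)) (\<lambda>z. x (inv_into V y z))"
  using smooth_manifold assms
  unfolding smooth_manifold_def smoothly_compatible_def comp_def by (fastforce simp: Int_commute)

lemma smooth_fun_openin: "smooth_fun M W f \<Longrightarrow> openin (space_of M) W"
  by (simp add: smooth_fun_def)

lemma smooth_fun_chartD:
  assumes "smooth_fun M W f" "(U, x) \<in> atlas M"
  shows "smooth_on (x ` (U \<inter> W)) (\<lambda>z. f (inv_into U x z))"
  using assms unfolding smooth_fun_def comp_def by blast

lemma smooth_funI:
  assumes "openin (space_of M) W"
    and "\<And>U x. (U, x) \<in> atlas M \<Longrightarrow> open (x ` (U \<inter> W)) \<Longrightarrow>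
      smooth_on (x ` (U \<inter> W)) (\<lambda>z. f (inv_into U x z))"
  shows "smooth_fun M W f"
  unfolding smooth_fun_def comp_def
  using assms chart_open_image[OF _ openin_Int[OF chart_openin assms(1)]] by fastforce

text \<open>Smoothness in a single chart suffices, since the transition maps are smooth.\<close>

lemma smooth_fun_chartI:
  assumes "(U, x) \<in> atlas M" "openin (space_of M) W" "W \<subseteq> U"
    and "smooth_on (x ` W) (\<lambda>z. f (inv_into U x z))"
  shows "smooth_fun M W f"
proof (rule smooth_funI[OF assms(2)])
  fix V y assume V: "(V, y) \<in> atlas M" and op: "open (y ` (V \<inter> W))"
  have inv: "x (inv_into V y z) \<in> x ` W" "f (inv_into V y z) = f (inv_into U x (x (inv_into V y z)))"
    if z: "z \<in> y ` (V \<inter> W)" for z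
  proof -
    obtain w where w: "w \<in> V" "w \<in> W" "z = y w" using z by blast
    then have "inv_into V y z = w" using chart_inverse[OF V] by simp
    moreover have "inv_into U x (x w) = w" using chart_inverse[OF assms(1)] assms(3) w(2) by blast
    ultimately show "x (inv_into V y z) \<in> x ` W"
      "f (inv_into V y z) = f (inv_into U x (x (inv_into V y z)))"
      using w(2) by simp_all
  qed
  have "V \<inter> W \<subseteq> V \<inter> U" using assms(3) by blast
  note trans = smooth_on_subset[OF chart_transition_smooth[OF assms(1) V] image_mono[OF this]]
  have "smooth_on (y ` (V \<inter> W)) (\<lambda>z. f (inv_into U x (x (inv_into V y z))))"
    by (rule smooth_on_compose[OF op chart_open_image[OF assms(1-3)] image_subsetI[OF inv(1)] trans assms(4)])
  with smooth_on_cong[OF op inv(2)]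
  show "smooth_on (y ` (V \<inter> W)) (\<lambda>z. f (inv_into V y z))" by (rule iffD2)
qed

lemma smooth_fun_cong:
  assumes "smooth_fun M W f" "\<And>w. w \<in> W \<Longrightarrow> f w = g w"
  shows "smooth_fun M W g"
proof (rule smooth_funI[OF smooth_fun_openin[OF assms(1)]])
  fix U x assume U: "(U, x) \<in> atlas M" and op: "open (x ` (U \<inter> W))"
  have "f (inv_into U x z) = g (inv_into U x z)" if "z \<in> x ` (U \<inter> W)" for z
    using that chart_inverse[OF U] assms(2) by auto
  with smooth_fun_chartD[OF assms(1) U] smooth_on_cong[OF op]
  show "smooth_on (x ` (U \<inter> W)) (\<lambda>z. g (inv_into U x z))" by metis
qed

lemma smooth_fun_subset:
  assumes "smooth_fun M W f" "W' \<subseteq> W" "openin (space_of M) W'"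
  shows "smooth_fun M W' f"
proof (rule smooth_funI[OF assms(3)])
  fix U x assume U: "(U, x) \<in> atlas M"
  show "smooth_on (x ` (U \<inter> W')) (\<lambda>z. f (inv_into U x z))"
    by (rule smooth_on_subset[OF smooth_fun_chartD[OF assms(1) U] image_mono[OF Int_mono[OF order_refl assms(2)]]])
qed

lemma smooth_fun_local:
  assumes "openin (space_of M) W" "\<And>u. u \<in> W \<Longrightarrow> smooth_near M u f"
  shows "smooth_fun M W f"
proof (rule smooth_funI[OF assms(1)])
  fix U x assume U: "(U, x) \<in> atlas M"
  show "smooth_on (x ` (U \<inter> W)) (\<lambda>z. f (inv_into U x z))"
  proof (rule smooth_on_local)
    fix z assume "z \<in> x ` (U \<inter> W)"
    then obtain u where u: "u \<in> U" "u \<in> W" "z = x u" by blast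
    obtain N where N: "u \<in> N" "smooth_fun M N f"
      using assms(2)[OF u(2)] unfolding smooth_near_def by (elim exE conjE)
    have "open (x ` (U \<inter> N))"
      by (rule chart_open_image[OF U openin_Int[OF chart_openin[OF U] smooth_fun_openin[OF N(2)]]]) simp
    moreover have "z \<in> x ` (U \<inter> N)" using u N(1) by blast
    ultimately show "\<exists>T. open T \<and> z \<in> T \<and> smooth_on T (\<lambda>z. f (inv_into U x z))"
      using smooth_fun_chartD[OF N(2) U] by (intro exI conjI)
  qed
qed

lemma smooth_fun_const: "openin (space_of M) W \<Longrightarrow> smooth_fun M W (\<lambda>_. c)"
  by (rule smooth_funI) (simp_all add: smooth_on_const)

lemma smooth_fun_add:
  assumes "smooth_fun M W f" "smooth_fun M W g"
  shows "smooth_fun M W (\<lambda>w. f w + g w)"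
  by (rule smooth_funI[OF smooth_fun_openin[OF assms(1)]])
    (rule smooth_on_add[OF _ smooth_fun_chartD[OF assms(1)] smooth_fun_chartD[OF assms(2)]])

lemma smooth_fun_mult:
  assumes "smooth_fun M W f" "smooth_fun M W g"
  shows "smooth_fun M W (\<lambda>w. f w * g w)"
  by (rule smooth_funI[OF smooth_fun_openin[OF assms(1)]])
    (rule smooth_on_mult[OF _ smooth_fun_chartD[OF assms(1)] smooth_fun_chartD[OF assms(2)]])

lemma smooth_fun_sum:
  assumes "openin (space_of M) W" "\<And>i. i \<in> I \<Longrightarrow> smooth_fun M W (f i)"
  shows "smooth_fun M W (\<lambda>w. \<Sum>i\<in>I. f i w)"
  using assms(2)
proof (induction I rule: infinite_finite_induct)
  case (insert i I)
  then show ?case by (simp add: smooth_fun_add)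
qed (simp_all add: smooth_fun_const assms(1))

lemma smooth_fun_compose_chart:
  assumes "(U, x) \<in> atlas M" "openin (space_of M) W" "W \<subseteq> U" "smooth_on (x ` W) g"
  shows "smooth_fun M W (\<lambda>w. g (x w))"
proof (rule smooth_fun_chartI[OF assms(1-3)])
  show "smooth_on (x ` W) (\<lambda>z. g (x (inv_into U x z)))"
    by (rule smooth_on_cong[OF chart_open_image[OF assms(1-3)], THEN iffD1, OF _ assms(4)])
      (use chart_inverse[OF assms(1)] assms(3) in auto)
qed

lemma smooth_fun_coordinate:
  assumes "(U, x) \<in> atlas M"
  shows "smooth_fun M U (\<lambda>w. x w $ p)"
  using chart_open_image[OF assms chart_openin[OF assms]]
  by (intro smooth_fun_compose_chart[OF assms chart_openin[OF assms], where g = "\<lambda>z. z $ p"]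
      smooth_on_bounded_linear bounded_linear_vec_nth) simp_all

lemma smooth_fun_partial:
  assumes "(U, x) \<in> atlas M" "smooth_fun M W f" "W \<subseteq> U"
  shows "smooth_fun M W (partial U x l f)"
proof -
  have "smooth_on (x ` W) (\<lambda>z. f (inv_into U x z))"
    using smooth_fun_chartD[OF assms(2,1)] assms(3) by (simp add: Int_absorb1)
  from smooth_fun_compose_chart[OF assms(1) smooth_fun_openin[OF assms(2)] assms(3)
      smooth_on_frechet_derivative[OF this]]
  show ?thesis unfolding partial_def comp_def .
qed

lemma smooth_nearE:
  assumes "smooth_near M u f"
  obtains W where "u \<in> W" "smooth_fun M W f"
  using assms unfolding smooth_near_def by (elim exE conjE)

lemma smooth_near_common_domain:
  assumes "smooth_near M u f" "smooth_near M u g"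
  obtains W where "u \<in> W" "openin (space_of M) W" "smooth_fun M W f" "smooth_fun M W g"
proof -
  obtain A where A: "u \<in> A" "smooth_fun M A f" using smooth_nearE[OF assms(1)] .
  obtain B where B: "u \<in> B" "smooth_fun M B g" using smooth_nearE[OF assms(2)] .
  have op: "openin (space_of M) (A \<inter> B)"
    by (rule openin_Int[OF smooth_fun_openin[OF A(2)] smooth_fun_openin[OF B(2)]])
  show ?thesis
    by (rule that[OF IntI[OF A(1) B(1)] op smooth_fun_subset[OF A(2) Int_lower1 op]
        smooth_fun_subset[OF B(2) Int_lower2 op]])
qed

lemma smooth_fun_imp_smooth_near: "smooth_fun M W f \<Longrightarrow> u \<in> W \<Longrightarrow> smooth_near M u f"
  unfolding smooth_near_def by (intro exI conjI)

lemma smooth_near_const: "u \<in> points M \<Longrightarrow> smooth_near M u (\<lambda>_. c)"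
  by (rule smooth_fun_imp_smooth_near[OF smooth_fun_const[OF openin_topspace]])

lemma smooth_near_add:
  assumes "smooth_near M u f" "smooth_near M u g"
  shows "smooth_near M u (\<lambda>w. f w + g w)"
proof -
  obtain W where W: "u \<in> W" "smooth_fun M W f" "smooth_fun M W g"
    using smooth_near_common_domain[OF assms] .
  show ?thesis
    by (rule smooth_fun_imp_smooth_near[OF smooth_fun_add[OF W(2,3)] W(1)])
qed

lemma smooth_near_mult:
  assumes "smooth_near M u f" "smooth_near M u g"
  shows "smooth_near M u (\<lambda>w. f w * g w)"
proof -
  obtain W where W: "u \<in> W" "smooth_fun M W f" "smooth_fun M W g"
    using smooth_near_common_domain[OF assms] .
  show ?thesis
    by (rule smooth_fun_imp_smooth_near[OF smooth_fun_mult[OF W(2,3)] W(1)])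
qed

lemma smooth_near_sum:
  assumes "u \<in> points M" "\<And>i. i \<in> I \<Longrightarrow> smooth_near M u (f i)"
  shows "smooth_near M u (\<lambda>w. \<Sum>i\<in>I. f i w)"
  using assms(2)
proof (induction I rule: infinite_finite_induct)
  case (insert i I)
  then show ?case by (simp add: smooth_near_add)
qed (simp_all add: smooth_near_const assms(1))

lemma agree_near_sym: "agree_near M u f g \<Longrightarrow> agree_near M u g f"
  unfolding agree_near_def by fastforce

lemma smooth_near_cong:
  assumes "agree_near M u f g" "smooth_near M u f"
  shows "smooth_near M u g"
proof -
  obtain A where A: "openin (space_of M) A" "u \<in> A" "\<And>w. w \<in> A \<Longrightarrow> f w = g w"
    using assms(1) unfolding agree_near_def by blast
  obtain B where B: "u \<in> B" "smooth_fun M B f"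
    using smooth_nearE[OF assms(2)] .
  have "smooth_fun M (A \<inter> B) f"
    by (rule smooth_fun_subset[OF B(2) Int_lower2 openin_Int[OF A(1) smooth_fun_openin[OF B(2)]]])
  then have "smooth_fun M (A \<inter> B) g" by (rule smooth_fun_cong) (use A(3) in auto)
  then show ?thesis using A(2) B(1) unfolding smooth_near_def by blast
qed


section \<open>Tangent vectors in coordinates\<close>

lemma tangent_add:
  "v \<in> tangent_space M u \<Longrightarrow> smooth_near M u f \<Longrightarrow> smooth_near M u g \<Longrightarrow>
    v (\<lambda>w. f w + g w) = v f + v g"
  unfolding tangent_space_def by blast

lemma tangent_scale:
  "v \<in> tangent_space M u \<Longrightarrow> smooth_near M u f \<Longrightarrow> v (\<lambda>w. c * f w) = c * v f"
  unfolding tangent_space_def by blast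

lemma tangent_mult:
  "v \<in> tangent_space M u \<Longrightarrow> smooth_near M u f \<Longrightarrow> smooth_near M u g \<Longrightarrow>
    v (\<lambda>w. f w * g w) = f u * v g + g u * v f"
  unfolding tangent_space_def by blast

lemma tangent_not_smooth: "v \<in> tangent_space M u \<Longrightarrow> \<not> smooth_near M u f \<Longrightarrow> v f = 0"
  unfolding tangent_space_def by blast

text \<open>Two functions with the same germ are either both smooth near \<open>u\<close> or both sent to the default
  value \<open>0\<close>, so equality of germs alone suffices.\<close>

lemma tangent_cong:
  assumes "v \<in> tangent_space M u" "agree_near M u f g"
  shows "v f = v g"
proof (cases "smooth_near M u f")
  case True
  then show ?thesis
    using assms smooth_near_cong[OF assms(2) True] unfolding tangent_space_def by blast
next
  case False
  then have "\<not> smooth_near M u g"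
    using smooth_near_cong[OF agree_near_sym[OF assms(2)]] by blast
  then show ?thesis using False tangent_not_smooth[OF assms(1)] by simp
qed

lemma tangent_const:
  assumes "v \<in> tangent_space M u" "u \<in> points M"
  shows "v (\<lambda>_. c) = 0"
proof -
  have "v (\<lambda>_. 1 * 1) = 1 * v (\<lambda>_. 1) + 1 * v (\<lambda>_. 1)"
    by (rule tangent_mult[OF assms(1)]) (rule smooth_near_const[OF assms(2)])+
  then have "v (\<lambda>_. 1) = 0" by simp
  then show ?thesis
    using tangent_scale[OF assms(1) smooth_near_const[OF assms(2)], of c 1] by simp
qed

lemma tangent_sum:
  assumes "v \<in> tangent_space M u" "u \<in> points M" "\<And>i. i \<in> I \<Longrightarrow> smooth_near M u (f i)"
  shows "v (\<lambda>w. \<Sum>i\<in>I. f i w) = (\<Sum>i\<in>I. v (f i))"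
  using assms(3)
proof (induction I rule: infinite_finite_induct)
  case (insert i I)
  then show ?case
    by (simp add: tangent_add[OF assms(1)] smooth_near_sum[OF assms(2)])
qed (simp_all add: tangent_const[OF assms(1,2)])

text \<open>By Hadamard's lemma \<open>f = f(u) + \<Sum>\<^sub>l (x\<^sup>l - x\<^sup>l(u)) g\<^sub>l\<close> near \<open>u\<close> with \<open>g\<^sub>l(u) = \<partial>f/\<partial>x\<^sup>l(u)\<close>, and
  the Leibniz rule kills every term in which the factor vanishing at \<open>u\<close> is not differentiated.\<close>

lemma tangent_vector_in_coordinates:
  assumes U: "(U, x) \<in> atlas M" and u: "u \<in> U"
    and v: "v \<in> tangent_space M u" and f: "smooth_near M u f"
  shows "v f = (\<Sum>l\<in>UNIV. coord_covector x l v * partial U x l f u)"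
proof -
  have up: "u \<in> points M" using u chart_subset_points[OF U] by blast
  obtain N where N: "u \<in> N" "smooth_fun M N f" using smooth_nearE[OF f] .
  have op: "open (x ` (U \<inter> N))"
    by (rule chart_open_image[OF U openin_Int[OF chart_openin[OF U] smooth_fun_openin[OF N(2)]]]) simp
  then obtain r where r: "r > 0" "ball (x u) r \<subseteq> x ` (U \<inter> N)"
    using u N(1) by (meson IntI imageI openE)
  let ?B = "ball (x u) r"
  have "smooth_on ?B (\<lambda>z. f (inv_into U x z))"
    using smooth_on_subset[OF smooth_fun_chartD[OF N(2) U] r(2)] .
  from hadamard[OF open_ball convex_ball _ this, of "x u"] r(1)
  obtain g where g: "\<And>i. smooth_on ?B (g i)"
    "\<And>i. g i (x u) = frechet_derivative (\<lambda>z. f (inv_into U x z)) (at (x u)) i"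
    "\<And>y. y \<in> ?B \<Longrightarrow> f (inv_into U x y) =
        f (inv_into U x (x u)) + (\<Sum>i\<in>Basis. ((y - x u) \<bullet> i) * g i y)"
    by auto
  define G where "G l w = g (axis l 1) (x w)" for l w
  define D where "D l w = x w $ l + - (x u $ l)" for l w
  let ?W = "{w \<in> U. x w \<in> ?B}"
  have W: "openin (space_of M) ?W" "?W \<subseteq> U" "u \<in> ?W"
    using chart_openin_preimage[OF U open_ball] u r(1) by auto
  have Basis_axis: "(\<Sum>i\<in>Basis. k i) = (\<Sum>l\<in>UNIV. k (axis l 1))" for k :: "real ^ 'n \<Rightarrow> real"
  proof -
    have "Basis = range (\<lambda>l::'n. axis l (1::real))" by (auto simp: Basis_vec_def)
    moreover have "inj (\<lambda>l::'n. axis l (1::real))" by (auto simp: inj_on_def axis_eq_axis)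
    ultimately show ?thesis
      using sum.reindex[of "\<lambda>l::'n. axis l (1::real)" UNIV k] by (simp only: comp_def)
  qed
  have "agree_near M u f (\<lambda>w. f u + (\<Sum>l\<in>UNIV. D l w * G l w))"
    unfolding agree_near_def
  proof (intro exI conjI ballI)
    fix w assume "w \<in> ?W"
    then show "f w = f u + (\<Sum>l\<in>UNIV. D l w * G l w)"
      using g(3)[of "x w"] chart_inverse[OF U] u
      by (simp add: Basis_axis D_def G_def inner_axis)
  qed (use W in auto)
  then have expansion: "v f = v (\<lambda>w. f u + (\<Sum>l\<in>UNIV. D l w * G l w))"
    by (rule tangent_cong[OF v])
  have coord: "smooth_near M u (\<lambda>w. x w $ l)" for l
    using smooth_fun_imp_smooth_near[OF smooth_fun_coordinate[OF U] u] .
  have D: "smooth_near M u (D l)" for l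
    unfolding D_def by (intro smooth_near_add smooth_near_const up coord)
  have G: "smooth_near M u (G l)" for l
    unfolding G_def
  proof (rule smooth_fun_imp_smooth_near[OF smooth_fun_compose_chart[OF U W(1,2)] W(3)])
    show "smooth_on (x ` ?W) (g (axis l 1))"
      by (rule smooth_on_subset[OF g(1)]) (simp add: image_subset_iff)
  qed
  note DG = smooth_near_mult[OF D G]
  have "v (\<lambda>w. f u + (\<Sum>l\<in>UNIV. D l w * G l w)) =
      v (\<lambda>_. f u) + v (\<lambda>w. \<Sum>l\<in>UNIV. D l w * G l w)"
    by (rule tangent_add[OF v smooth_near_const[OF up] smooth_near_sum[OF up DG]])
  also have "\<dots> = (\<Sum>l\<in>UNIV. v (\<lambda>w. D l w * G l w))"
    using tangent_sum[OF v up DG] tangent_const[OF v up] by simp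
  also have "\<dots> = (\<Sum>l\<in>UNIV. coord_covector x l v * partial U x l f u)"
  proof (rule sum.cong[OF refl])
    fix l
    have "v (D l) = v (\<lambda>w. x w $ l) + v (\<lambda>_. - (x u $ l))"
      unfolding D_def by (rule tangent_add[OF v coord smooth_near_const[OF up]])
    then have "v (D l) = coord_covector x l v"
      unfolding coord_covector_def tangent_const[OF v up] by simp
    moreover have "D l u = 0" by (simp add: D_def)
    moreover have "G l u = partial U x l f u"
      by (simp add: G_def g(2) partial_def comp_def)
    ultimately show "v (\<lambda>w. D l w * G l w) = coord_covector x l v * partial U x l f u"
      using tangent_mult[OF v D[of l] G[of l]] by simp
  qed
  finally show ?thesis using expansion by simp
qed


section \<open>Vector fields\<close>

lemma vector_field_tangent: "X \<in> vector_fields M W \<Longrightarrow> u \<in> W \<Longrightarrow> X u \<in> tangent_space M u"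
  unfolding vector_fields_def by blast

lemma vector_field_coordinate_smooth:
  assumes "X \<in> vector_fields M W" "(U, x) \<in> atlas M"
  shows "smooth_fun M (U \<inter> W) (dx_op x p X)"
  using assms unfolding vector_fields_def dx_op_def by blast

text \<open>In coordinates \<open>X f = \<Sum>\<^sub>l X\<^sup>l \<partial>f/\<partial>x\<^sup>l\<close>, a sum of products of smooth functions.\<close>

lemma smooth_near_act:
  assumes W: "openin (space_of M) W" and X: "X \<in> vector_fields M W" and u: "u \<in> W"
    and f: "smooth_near M u f"
  shows "smooth_near M u (act X f)"
proof -
  have "u \<in> points M" using openin_subset[OF W] u by blast
  then obtain U x where U: "(U, x) \<in> atlas M" "u \<in> U" using chart_at by blast
  obtain N where N: "u \<in> N" "smooth_fun M N f" using smooth_nearE[OF f] .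
  let ?N = "N \<inter> U \<inter> W"
  have op: "openin (space_of M) ?N"
    using smooth_fun_openin[OF N(2)] chart_openin[OF U(1)] W by blast
  have "smooth_fun M ?N (dx_op x l X)" for l
    by (rule smooth_fun_subset[OF vector_field_coordinate_smooth[OF X U(1)] _ op]) blast
  moreover have "smooth_fun M ?N (partial U x l f)" for l
    by (rule smooth_fun_partial[OF U(1) smooth_fun_subset[OF N(2) _ op]]) auto
  ultimately have "smooth_fun M ?N (\<lambda>w. \<Sum>l\<in>UNIV. dx_op x l X w * partial U x l f w)"
    by (intro smooth_fun_sum op smooth_fun_mult)
  then have "smooth_fun M ?N (act X f)"
  proof (rule smooth_fun_cong)
    fix w assume w: "w \<in> ?N"
    have "X w f = (\<Sum>l\<in>UNIV. coord_covector x l (X w) * partial U x l f w)"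
      by (rule tangent_vector_in_coordinates[OF U(1) _ vector_field_tangent[OF X]
            smooth_fun_imp_smooth_near[OF N(2)]]) (use w in simp_all)
    then show "(\<Sum>l\<in>UNIV. dx_op x l X w * partial U x l f w) = act X f w"
      by (simp add: act_def dx_op_def)
  qed
  then show ?thesis by (rule smooth_fun_imp_smooth_near) (use N(1) U(2) u in simp)
qed

lemma agree_near_act:
  assumes "agree_near M u X Y"
  shows "agree_near M u (act X f) (act Y f)"
  using assms unfolding agree_near_def act_def by metis

text \<open>In \<open>X(Y(fg)) - Y(X(fg))\<close> the mixed products of first derivatives cancel by symmetry.\<close>

lemma bracket_tangent:
  assumes W: "openin (space_of M) W" and X: "X \<in> vector_fields M W" and Y: "Y \<in> vector_fields M W"
    and u: "u \<in> W"
  shows "bracket M X Y u \<in> tangent_space M u"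
proof -
  have up: "u \<in> points M" using openin_subset[OF W] u by blast
  have agree: "agree_near M u (act Z F) H"
    if Z: "Z \<in> vector_fields M W" and f: "smooth_near M u f" and g: "smooth_near M u g"
      and eq: "\<And>w. w \<in> W \<Longrightarrow> smooth_near M w f \<Longrightarrow> smooth_near M w g \<Longrightarrow> Z w F = H w"
    for Z F H f g
  proof -
    obtain N where N: "u \<in> N" "openin (space_of M) N" "smooth_fun M N f" "smooth_fun M N g"
      using smooth_near_common_domain[OF f g] .
    have "act Z F w = H w" if "w \<in> N \<inter> W" for w
      unfolding act_def using that
      by (intro eq smooth_fun_imp_smooth_near[OF N(3)] smooth_fun_imp_smooth_near[OF N(4)]) auto
    moreover have "openin (space_of M) (N \<inter> W)" "u \<in> N \<inter> W" using N(1,2) W u by auto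
    ultimately show ?thesis unfolding agree_near_def by (intro exI[of _ "N \<inter> W"]) simp
  qed
  note tan = vector_field_tangent[OF X] vector_field_tangent[OF Y]
  have second_add: "P u (act Q (\<lambda>w. f w + g w)) = P u (act Q f) + P u (act Q g)"
    if P: "P \<in> vector_fields M W" and Q: "Q \<in> vector_fields M W"
      and f: "smooth_near M u f" and g: "smooth_near M u g" for P Q f g
  proof -
    have "agree_near M u (act Q (\<lambda>w. f w + g w)) (\<lambda>w. act Q f w + act Q g w)"
      by (rule agree[OF Q f g]) (simp add: act_def tangent_add[OF vector_field_tangent[OF Q]])
    from tangent_cong[OF vector_field_tangent[OF P u] this] show ?thesis
      unfolding tangent_add[OF vector_field_tangent[OF P u] smooth_near_act[OF W Q u f]
          smooth_near_act[OF W Q u g]] .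
  qed
  have second_scale: "P u (act Q (\<lambda>w. c * f w)) = c * P u (act Q f)"
    if P: "P \<in> vector_fields M W" and Q: "Q \<in> vector_fields M W"
      and f: "smooth_near M u f" for P Q f c
  proof -
    have "agree_near M u (act Q (\<lambda>w. c * f w)) (\<lambda>w. c * act Q f w)"
      by (rule agree[OF Q f f]) (simp add: act_def tangent_scale[OF vector_field_tangent[OF Q]])
    from tangent_cong[OF vector_field_tangent[OF P u] this] show ?thesis
      unfolding tangent_scale[OF vector_field_tangent[OF P u] smooth_near_act[OF W Q u f]] .
  qed
  have second_mult: "P u (act Q (\<lambda>w. f w * g w)) =
      f u * P u (act Q g) + Q u g * P u f + (g u * P u (act Q f) + Q u f * P u g)"
    if P: "P \<in> vector_fields M W" and Q: "Q \<in> vector_fields M W"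
      and f: "smooth_near M u f" and g: "smooth_near M u g" for P Q f g
  proof -
    note PT = vector_field_tangent[OF P u]
    note s = smooth_near_act[OF W Q u f] smooth_near_act[OF W Q u g]
    have "agree_near M u (act Q (\<lambda>w. f w * g w)) (\<lambda>w. f w * act Q g w + g w * act Q f w)"
      by (rule agree[OF Q f g]) (simp add: act_def tangent_mult[OF vector_field_tangent[OF Q]])
    from tangent_cong[OF PT this]
    have "P u (act Q (\<lambda>w. f w * g w)) = P u (\<lambda>w. f w * act Q g w) + P u (\<lambda>w. g w * act Q f w)"
      using tangent_add[OF PT smooth_near_mult[OF f s(2)] smooth_near_mult[OF g s(1)]] by simp
    then show ?thesis
      unfolding tangent_mult[OF PT f s(2)] tangent_mult[OF PT g s(1)] by (simp add: act_def)
  qed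
  have second_cong: "P u (act Q f) = P u (act Q g)"
    if P: "P \<in> vector_fields M W" and Q: "Q \<in> vector_fields M W" and fg: "agree_near M u f g" for P Q f g
  proof -
    obtain N where N: "openin (space_of M) N" "u \<in> N" "\<forall>w\<in>N. f w = g w"
      using fg unfolding agree_near_def by blast
    have "\<forall>w \<in> N \<inter> W. act Q f w = act Q g w"
    proof
      fix w assume w: "w \<in> N \<inter> W"
      then have "agree_near M w f g" using N unfolding agree_near_def by blast
      from tangent_cong[OF vector_field_tangent[OF Q] this] w
      show "act Q f w = act Q g w" by (simp add: act_def)
    qed
    moreover have "openin (space_of M) (N \<inter> W)" "u \<in> N \<inter> W" using N W u by auto
    ultimately have "agree_near M u (act Q f) (act Q g)" unfolding agree_near_def by blast
    then show ?thesis by (rule tangent_cong[OF vector_field_tangent[OF P u]])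
  qed
  \<comment> \<open>The four facts above hold for both orders of \<open>X\<close> and \<open>Y\<close>; the bracket takes their difference.\<close>
  show ?thesis
    unfolding tangent_space_def mem_Collect_eq
  proof (intro conjI allI impI)
    fix f g assume fg: "smooth_near M u f" "smooth_near M u g"
    show "bracket M X Y u (\<lambda>w. f w + g w) = bracket M X Y u f + bracket M X Y u g"
      using fg smooth_near_add[OF fg]
      by (simp add: bracket_def second_add[OF X Y fg] second_add[OF Y X fg])
    show "bracket M X Y u (\<lambda>w. f w * g w) = f u * bracket M X Y u g + g u * bracket M X Y u f"
      using fg smooth_near_mult[OF fg]
      by (simp add: bracket_def second_mult[OF X Y fg] second_mult[OF Y X fg] algebra_simps)
    assume "agree_near M u f g"
    then show "bracket M X Y u f = bracket M X Y u g"
      using fg second_cong[OF X Y] second_cong[OF Y X] by (simp add: bracket_def)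
  next
    fix c f
    assume f: "smooth_near M u f"
    then have "smooth_near M u (\<lambda>w. c * f w)"
      by (intro smooth_near_mult smooth_near_const up)
    then show "bracket M X Y u (\<lambda>w. c * f w) = c * bracket M X Y u f"
      using f by (simp add: bracket_def second_scale[OF X Y] second_scale[OF Y X] algebra_simps)
  next
    fix f assume "\<not> smooth_near M u f"
    then show "bracket M X Y u f = 0" by (simp add: bracket_def)
  qed
qed

lemma bracket_local:
  assumes "X u \<in> tangent_space M u" "Y u \<in> tangent_space M u"
    and X: "agree_near M u X X'" and Y: "agree_near M u Y Y'"
  shows "bracket M X Y u = bracket M X' Y' u"
proof -
  have "X u = X' u" "Y u = Y' u" using X Y unfolding agree_near_def by blast+
  then show ?thesis
    using tangent_cong[OF assms(1) agree_near_act[OF Y]] tangent_cong[OF assms(2) agree_near_act[OF X]]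
    by (simp add: bracket_def fun_eq_iff)
qed

text \<open>Multiplying by a bump function supported in a coordinate ball extends the germ of a field.
  The extension by zero is smooth because the closed coordinate ball is compact, hence closed in the
  Hausdorff space of points, so that every point outside it has a neighbourhood where the product
  vanishes.\<close>

lemma vector_field_germ_extends:
  assumes W: "openin (space_of M) W" and X: "X \<in> vector_fields M W" and u: "u \<in> W"
  obtains Y where "Y \<in> vector_fields M (points M)" "agree_near M u X Y"
proof -
  have Wp: "W \<subseteq> points M" using openin_subset[OF W] .
  then obtain U x where U: "(U, x) \<in> atlas M" and uU: "u \<in> U" using u chart_at by blast
  have UW: "openin (space_of M) (U \<inter> W)" using chart_openin[OF U] W by blast
  have "open (x ` (U \<inter> W))" by (rule chart_open_image[OF U UW]) simp
  moreover have "x u \<in> x ` (U \<inter> W)" using u uU by blast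
  ultimately obtain r where r: "r > 0" "cball (x u) r \<subseteq> x ` (U \<inter> W)"
    using open_contains_cball by blast
  obtain h :: "real ^ 'n \<Rightarrow> real" where h: "smooth_on UNIV h"
    "\<And>y. dist (x u) y \<le> r / 2 \<Longrightarrow> h y = 1" "\<And>y. dist (x u) y \<ge> r \<Longrightarrow> h y = 0"
    by (rule smooth_bump[OF r(1), of "x u"]) blast
  define K where "K = {w \<in> U. x w \<in> cball (x u) r}"
  have KW: "K \<subseteq> U \<inter> W"
  proof
    fix w assume "w \<in> K"
    then have w: "w \<in> U" "x w \<in> x ` (U \<inter> W)" using r(2) by (auto simp: K_def)
    then obtain w' where "w' \<in> U \<inter> W" "x w = x w'" by blast
    then show "w \<in> U \<inter> W" using w(1) inj_onD[OF chart_inj_on[OF U]] by blast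
  qed
  \<comment> \<open>\<open>K\<close> is the image of a compact ball under the inverse of the chart.\<close>
  have K_closed: "closedin (space_of M) K"
  proof -
    obtain k where k: "homeomorphic_maps (subtopology (space_of M) U) (top_of_set (x ` U)) x k"
      using chart_homeomorphic_map[OF U] homeomorphic_map_maps by blast
    have kx: "k (x w) = w" if "w \<in> U" for w
    proof -
      have "w \<in> topspace (subtopology (space_of M) U)"
        using that chart_subset_points[OF U] by (simp add: topspace_subtopology subset_iff)
      then show ?thesis using k unfolding homeomorphic_maps_def by blast
    qed
    have "compactin (top_of_set (x ` U)) (cball (x u) r)"
      using r(2) by (auto simp: compactin_subtopology)
    then have "compactin (subtopology (space_of M) U) (k ` cball (x u) r)"
      by (rule image_compactin) (use k in \<open>simp add: homeomorphic_maps_def\<close>)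
    then have "compactin (space_of M) (k ` cball (x u) r)" by (simp add: compactin_subtopology)
    moreover have "k ` cball (x u) r = K"
    proof -
      have "cball (x u) r = x ` K"
      proof
        show "cball (x u) r \<subseteq> x ` K"
        proof
          fix z assume z: "z \<in> cball (x u) r"
          then obtain w where "w \<in> U" "z = x w" using r(2) by blast
          then show "z \<in> x ` K" using z unfolding K_def by blast
        qed
      qed (auto simp: K_def)
      then have "k ` cball (x u) r = (\<lambda>w. k (x w)) ` K" by (simp only: image_image)
      also have "\<dots> = (\<lambda>w. w) ` K" by (rule image_cong[OF refl]) (simp add: K_def kx)
      finally show ?thesis by simp
    qed
    moreover have "Hausdorff_space (space_of M)"
      using smooth_manifold unfolding smooth_manifold_def by blast
    ultimately show ?thesis using compactin_imp_closedin by blast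
  qed
  define \<eta> where "\<eta> w = (if w \<in> U then h (x w) else 0)" for w
  have \<eta>_outside: "\<eta> w = 0" if "w \<notin> K" for w
    using that h(3)[of "x w"] by (auto simp: \<eta>_def K_def)
  define Y where "Y w = (\<lambda>f. \<eta> w * X w f)" for w
  have "Y \<in> vector_fields M (points M)"
    unfolding vector_fields_def
  proof (intro CollectI conjI ballI allI impI)
    fix w assume w: "w \<in> points M"
    show "Y w \<in> tangent_space M w"
    proof (cases "w \<in> W")
      case True
      note T = vector_field_tangent[OF X True]
      show ?thesis
        unfolding tangent_space_def mem_Collect_eq Y_def
      proof (intro conjI allI impI)
        fix f g assume fg: "smooth_near M w f" "smooth_near M w g"
        show "\<eta> w * X w (\<lambda>w. f w + g w) = \<eta> w * X w f + \<eta> w * X w g"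
          unfolding tangent_add[OF T fg] by (rule distrib_left)
        show "\<eta> w * X w (\<lambda>w. f w * g w) = f w * (\<eta> w * X w g) + g w * (\<eta> w * X w f)"
          unfolding tangent_mult[OF T fg] by (simp add: algebra_simps)
        show "\<eta> w * X w f = \<eta> w * X w g" if "agree_near M w f g"
          unfolding tangent_cong[OF T that] ..
      next
        fix c f assume f: "smooth_near M w f"
        show "\<eta> w * X w (\<lambda>w. c * f w) = c * (\<eta> w * X w f)"
          unfolding tangent_scale[OF T f] by simp
      next
        fix f assume f: "\<not> smooth_near M w f"
        show "\<eta> w * X w f = 0" unfolding tangent_not_smooth[OF T f] by simp
      qed
    next
      case False
      then have "\<eta> w = 0" using KW \<eta>_outside by blast
      then show ?thesis unfolding Y_def tangent_space_def by simp
    qed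
  next
    fix w assume "w \<notin> points M"
    then have "\<eta> w = 0" using KW Wp \<eta>_outside by blast
    then show "Y w = (\<lambda>_. 0)" by (simp add: Y_def)
  next
    have "smooth_fun M (V \<inter> points M) (\<lambda>w. coord_covector y p (Y w))" if V: "(V, y) \<in> atlas M" for V y p
    proof (rule smooth_fun_local)
      show "openin (space_of M) (V \<inter> points M)" using chart_openin[OF V] by blast
      fix w assume w: "w \<in> V \<inter> points M"
      show "smooth_near M w (\<lambda>w. coord_covector y p (Y w))"
      proof (cases "w \<in> K")
        case True
        have op: "openin (space_of M) (U \<inter> W \<inter> V)" using UW chart_openin[OF V] by blast
        have "smooth_fun M (U \<inter> W \<inter> V) (\<lambda>w. h (x w))"
          by (rule smooth_fun_compose_chart[OF U op]) (blast, rule smooth_on_subset[OF h(1)], simp)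
        moreover have "smooth_fun M (U \<inter> W \<inter> V) (dx_op y p X)"
          by (rule smooth_fun_subset[OF vector_field_coordinate_smooth[OF X V] _ op]) blast
        ultimately have "smooth_fun M (U \<inter> W \<inter> V) (\<lambda>w. h (x w) * dx_op y p X w)"
          by (rule smooth_fun_mult)
        then have "smooth_fun M (U \<inter> W \<inter> V) (\<lambda>w. coord_covector y p (Y w))"
          by (rule smooth_fun_cong) (simp add: Y_def \<eta>_def dx_op_def coord_covector_def)
        then show ?thesis
          by (rule smooth_fun_imp_smooth_near) (use True KW w in blast)
      next
        case False
        have "openin (space_of M) (points M - K)"
          by (rule openin_diff[OF openin_topspace K_closed])
        from smooth_fun_const[OF this, of 0]
        have "smooth_fun M (points M - K) (\<lambda>w. coord_covector y p (Y w))"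
          by (rule smooth_fun_cong) (simp add: Y_def \<eta>_outside coord_covector_def)
        then show ?thesis by (rule smooth_fun_imp_smooth_near) (use False w in blast)
      qed
    qed
    then show "case a of (V, y) \<Rightarrow> \<forall>p. smooth_fun M (V \<inter> points M) (\<lambda>w. coord_covector y p (Y w))"
      if "a \<in> atlas M" for a
      using that by (cases a) simp
  qed
  moreover have "agree_near M u X Y"
    unfolding agree_near_def
  proof (intro exI conjI ballI)
    show "openin (space_of M) {w \<in> U. x w \<in> ball (x u) (r / 2)}"
      by (rule chart_openin_preimage[OF U open_ball])
    show "u \<in> {w \<in> U. x w \<in> ball (x u) (r / 2)}" using uU r(1) by simp
    fix w assume "w \<in> {w \<in> U. x w \<in> ball (x u) (r / 2)}"
    then have "\<eta> w = 1" using h(2)[of "x w"] by (simp add: \<eta>_def)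
    then show "X w = Y w" by (simp add: Y_def)
  qed
  ultimately show ?thesis by (rule that)
qed


section \<open>The Leibniz coboundary of a tensor\<close>

lemma agree_near_map:
  assumes "u \<in> points M" "list_all2 (agree_near M u) Xs Ys"
  shows "agree_near M u (\<lambda>w. map (\<lambda>X. X w) Xs) (\<lambda>w. map (\<lambda>Y. Y w) Ys)"
  using assms(2)
proof (induction rule: list_all2_induct)
  case Nil
  then show ?case using assms(1) unfolding agree_near_def by (intro exI[of _ "points M"]) simp
next
  case (Cons X Xs Y Ys)
  obtain A where A: "openin (space_of M) A" "u \<in> A" "\<forall>w\<in>A. X w = Y w"
    using Cons.hyps(1) unfolding agree_near_def by (elim exE conjE)
  obtain B where B: "openin (space_of M) B" "u \<in> B" "\<forall>w\<in>B. map (\<lambda>X. X w) Xs = map (\<lambda>Y. Y w) Ys"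
    using Cons.IH unfolding agree_near_def by (elim exE conjE)
  show ?case
    unfolding agree_near_def
    by (intro exI[of _ "A \<inter> B"]) (use A B in \<open>simp add: openin_Int\<close>)
qed

lemma agree_near_tensor_map:
  assumes "u \<in> points M" "list_all2 (agree_near M u) Xs Ys"
  shows "agree_near M u (tensor_map \<omega> Xs) (tensor_map \<omega> Ys)"
proof -
  obtain A where "openin (space_of M) A" "u \<in> A" "\<forall>w\<in>A. map (\<lambda>X. X w) Xs = map (\<lambda>Y. Y w) Ys"
    using agree_near_map[OF assms] unfolding agree_near_def by (elim exE conjE)
  then show ?thesis
    unfolding agree_near_def tensor_map_def by (intro exI[of _ A]) simp
qed

lemma list_all2_omit: "list_all2 P xs ys \<Longrightarrow> list_all2 P (omit i xs) (omit i ys)"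
  unfolding omit_def by (intro list_all2_appendI list_all2_takeI list_all2_dropI)

lemma map_omit: "map f (omit i xs) = omit i (map f xs)"
  by (simp add: omit_def take_map drop_map)

text \<open>Brackets and directional derivatives depend on germs only, and \<open>\<omega>\<close> only on values.\<close>

lemma leibniz_coboundary_local:
  assumes u: "u \<in> points M" and tangent: "\<And>X. X \<in> set Xs \<Longrightarrow> X u \<in> tangent_space M u"
    and agree: "list_all2 (agree_near M u) Xs Ys"
  shows "leibniz_coboundary M (tensor_map \<omega>) Xs u = leibniz_coboundary M (tensor_map \<omega>) Ys u"
proof -
  have len: "length Xs = length Ys" using list_all2_lengthD[OF agree] .
  have nth: "agree_near M u (Xs ! i) (Ys ! i)" "(Xs ! i) u \<in> tangent_space M u" "(Xs ! i) u = (Ys ! i) u"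
    if i: "i < length Xs" for i
  proof -
    show "agree_near M u (Xs ! i) (Ys ! i)" by (rule list_all2_nthD[OF agree i])
    then show "(Xs ! i) u = (Ys ! i) u" unfolding agree_near_def by blast
    show "(Xs ! i) u \<in> tangent_space M u" by (rule tangent[OF nth_mem[OF i]])
  qed
  have vals: "map (\<lambda>X. X u) Xs = map (\<lambda>Y. Y u) Ys"
    using len nth(3) by (simp add: list_eq_iff_nth_eq)
  have "act (Xs ! i) (tensor_map \<omega> (omit i Xs)) u = act (Ys ! i) (tensor_map \<omega> (omit i Ys)) u"
    if i: "i < length Xs" for i
    using tangent_cong[OF nth(2)[OF i] agree_near_tensor_map[OF u list_all2_omit[OF agree]]] nth(3)[OF i]
    unfolding act_def by simp
  moreover have "tensor_map \<omega> (omit j (Xs[i := bracket M (Xs ! i) (Xs ! j)])) u =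
      tensor_map \<omega> (omit j (Ys[i := bracket M (Ys ! i) (Ys ! j)])) u"
    if "i < length Xs" "j < length Xs" for i j
    unfolding tensor_map_def map_omit map_update vals
      bracket_local[OF nth(2)[OF that(1)] nth(2)[OF that(2)] nth(1)[OF that(1)] nth(1)[OF that(2)]] ..
  ultimately show ?thesis
    unfolding leibniz_coboundary_def len[symmetric]
    by (intro arg_cong2[of _ _ _ _ "(+)"] sum.cong refl) simp_all
qed

text \<open>Extending each germ to a global field gives existence of the described value, and locality of the
  coboundary gives its uniqueness.\<close>

lemma local_coboundary_eq:
  assumes W: "openin (space_of M) W" and X: "set Xs \<subseteq> vector_fields M W" and u: "u \<in> W"
  shows "local_coboundary M \<omega> Xs u = leibniz_coboundary M (tensor_map \<omega>) Xs u"
  unfolding local_coboundary_def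
proof (rule the_equality)
  let ?P = "\<lambda>X Y. Y \<in> vector_fields M (points M) \<and> agree_near M u X Y"
  have eq: "leibniz_coboundary M (tensor_map \<omega>) Ys u = leibniz_coboundary M (tensor_map \<omega>) Xs u"
    if "list_all2 ?P Xs Ys" for Ys
  proof (rule leibniz_coboundary_local[symmetric])
    show "u \<in> points M" using openin_subset[OF W] u by blast
    show "\<And>X. X \<in> set Xs \<Longrightarrow> X u \<in> tangent_space M u"
      using X vector_field_tangent[OF _ u] by blast
    show "list_all2 (agree_near M u) Xs Ys"
      by (rule list_all2_mono[OF that]) simp
  qed
  have "\<exists>Ys. list_all2 ?P Xs Ys" using X
  proof (induction Xs)
    case (Cons X Xs)
    then obtain Ys where "list_all2 ?P Xs Ys" by auto
    moreover obtain Y where "?P X Y" using vector_field_germ_extends[OF W _ u, of X] Cons.prems by auto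
    ultimately have "list_all2 ?P (X # Xs) (Y # Ys)" by simp
    then show ?case by (rule exI)
  qed (simp add: exI[of _ "[]"])
  then obtain Ys where Ys: "list_all2 ?P Xs Ys" ..
  then show "\<exists>Ys. list_all2 ?P Xs Ys \<and>
      leibniz_coboundary M (tensor_map \<omega>) Xs u = leibniz_coboundary M (tensor_map \<omega>) Ys u"
    using eq[OF Ys] by (intro exI[of _ Ys]) simp
  show "r = leibniz_coboundary M (tensor_map \<omega>) Xs u"
    if "\<exists>Ys. list_all2 ?P Xs Ys \<and> r = leibniz_coboundary M (tensor_map \<omega>) Ys u" for r
    using that eq by (elim exE conjE) simp
qed

lemma leibniz_coboundary_2:
  "leibniz_coboundary M (tensor_map \<omega>) [X1, X2, X3] u =
    X1 u (tensor_map \<omega> [X2, X3]) - X2 u (tensor_map \<omega> [X1, X3]) + X3 u (tensor_map \<omega> [X1, X2])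
    - \<omega> u [bracket M X1 X2 u, X3 u] + \<omega> u [bracket M X1 X3 u, X2 u] + \<omega> u [X1 u, bracket M X2 X3 u]"
  by (simp add: leibniz_coboundary_def act_def omit_def tensor_map_def lessThan_Suc numeral_2_eq_2)

lemma coord_covector_bracket:
  assumes "(U, x) \<in> atlas M" "u \<in> U"
  shows "coord_covector x p (bracket M X Y u) = X u (dx_op x p Y) - Y u (dx_op x p X)"
proof -
  have "smooth_near M u (\<lambda>w. x w $ p)"
    by (rule smooth_fun_imp_smooth_near[OF smooth_fun_coordinate[OF assms(1)] assms(2)])
  moreover have "act Z (\<lambda>w. x w $ p) = dx_op x p Z" for Z
    by (simp add: act_def dx_op_def coord_covector_def)
  ultimately show ?thesis by (simp add: coord_covector_def bracket_def)
qed

lemma vector_field_dx_op_smooth: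
  assumes "(U, x) \<in> atlas M" "X \<in> vector_fields M U" "u \<in> U"
  shows "smooth_near M u (dx_op x p X)"
  by (rule smooth_fun_imp_smooth_near[OF vector_field_coordinate_smooth[OF assms(2,1)]])
    (simp add: assms(3))

text \<open>On \<open>U\<close> the function \<open>\<omega>(X, Y)\<close> is \<open>\<Sum>\<^sub>p\<^sub>q a\<^sub>p\<^sub>q X\<^sup>p Y\<^sup>q\<close>, to which the Leibniz rule applies twice.\<close>

lemma tangent_two_tensor:
  assumes U: "(U, x) \<in> atlas M" and u: "u \<in> U" and v: "v \<in> tangent_space M u"
    and a: "\<And>p q. smooth_fun M U (a p q)"
    and \<omega>: "\<And>w v v'. w \<in> U \<Longrightarrow> v \<in> tangent_space M w \<Longrightarrow> v' \<in> tangent_space M w \<Longrightarrow>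
      \<omega> w [v, v'] = (\<Sum>p\<in>UNIV. \<Sum>q\<in>UNIV. a p q w * (coord_covector x p v * coord_covector x q v'))"
    and X: "X \<in> vector_fields M U" and Y: "Y \<in> vector_fields M U"
  shows "v (tensor_map \<omega> [X, Y]) = (\<Sum>p\<in>UNIV. \<Sum>q\<in>UNIV.
      v (a p q) * dx_op x p X u * dx_op x q Y u
    + a p q u * v (dx_op x p X) * dx_op x q Y u
    + a p q u * dx_op x p X u * v (dx_op x q Y))"
proof -
  have up: "u \<in> points M" using chart_subset_points[OF U] u by blast
  have a_near: "smooth_near M u (a p q)" for p q
    by (rule smooth_fun_imp_smooth_near[OF a u])
  note X_near = vector_field_dx_op_smooth[OF U X u] and Y_near = vector_field_dx_op_smooth[OF U Y u]
  note XY_near = smooth_near_mult[OF X_near Y_near]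
  note aXY_near = smooth_near_mult[OF a_near XY_near]
  have "agree_near M u (tensor_map \<omega> [X, Y])
      (\<lambda>w. \<Sum>p\<in>UNIV. \<Sum>q\<in>UNIV. a p q w * (dx_op x p X w * dx_op x q Y w))"
    unfolding agree_near_def
  proof (intro exI conjI ballI)
    fix w assume w: "w \<in> U"
    show "tensor_map \<omega> [X, Y] w = (\<Sum>p\<in>UNIV. \<Sum>q\<in>UNIV. a p q w * (dx_op x p X w * dx_op x q Y w))"
      using \<omega>[OF w vector_field_tangent[OF X w] vector_field_tangent[OF Y w]]
      by (simp add: tensor_map_def dx_op_def)
  qed (rule chart_openin[OF U], rule u)
  from tangent_cong[OF v this]
  have "v (tensor_map \<omega> [X, Y]) =
      (\<Sum>p\<in>UNIV. \<Sum>q\<in>UNIV. v (\<lambda>w. a p q w * (dx_op x p X w * dx_op x q Y w)))"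
    unfolding tangent_sum[OF v up smooth_near_sum[OF up aXY_near]] tangent_sum[OF v up aXY_near] .
  also have "\<dots> = (\<Sum>p\<in>UNIV. \<Sum>q\<in>UNIV.
      v (a p q) * dx_op x p X u * dx_op x q Y u
    + a p q u * v (dx_op x p X) * dx_op x q Y u
    + a p q u * dx_op x p X u * v (dx_op x q Y))"
    unfolding tangent_mult[OF v a_near XY_near] tangent_mult[OF v X_near Y_near]
    by (intro sum.cong refl) (simp add: algebra_simps)
  finally show ?thesis .
qed

end

theorem lemma3p2:
  fixes M :: "('m, 'n::finite) manifold"
    and U :: "'m set" and x :: "'m \<Rightarrow> real ^ 'n"
    and \<omega> :: "'m tensor_field"
    and a :: "'n \<Rightarrow> 'n \<Rightarrow> 'm \<Rightarrow> real"
    and X1 X2 X3 :: "'m vector_field" and u :: 'm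
  assumes "smooth_manifold M"
    and "(U, x) \<in> atlas M"
    and "is_tensor M 2 \<omega>"
    and "\<And>p q. smooth_fun M U (a p q)"
    and "\<And>w v v'. w \<in> U \<Longrightarrow> v \<in> tangent_space M w \<Longrightarrow> v' \<in> tangent_space M w \<Longrightarrow>
           \<omega> w [v, v'] = (\<Sum>p\<in>UNIV. \<Sum>q\<in>UNIV. a p q w * (coord_covector x p v * coord_covector x q v'))"
    and "X1 \<in> vector_fields M U" and "X2 \<in> vector_fields M U" and "X3 \<in> vector_fields M U"
    and "u \<in> U"
  shows "local_coboundary M \<omega> [X1, X2, X3] u =
    (\<Sum>p\<in>UNIV. \<Sum>q\<in>UNIV.
        (\<Sum>l\<in>UNIV. partial U x l (a p q) u * tensor3 (dx_op x l) (dx_op x p) (dx_op x q) [X1, X2, X3] u)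
      - (\<Sum>l\<in>UNIV. partial U x l (a p q) u * tensor3 (dx_op x p) (dx_op x l) (dx_op x q) [X1, X2, X3] u)
      + (\<Sum>l\<in>UNIV. partial U x l (a p q) u * tensor3 (dx_op x p) (dx_op x q) (dx_op x l) [X1, X2, X3] u)
      + (\<Sum>l\<in>UNIV. a p q u * tensor3 (dx_op x l) (dx_op x p) (partial_dx_op U x l q) [X1, X2, X3] u)
      + (\<Sum>l\<in>UNIV. a p q u * tensor3 (dx_op x l) (dx_op x q) (partial_dx_op U x l p) [X1, X2, X3] u))"
proof -
  interpret smooth_mfd M by unfold_locales (rule assms(1))
  note U = assms(2) and a = assms(4) and \<omega> = assms(5) and X = assms(6-8) and u = assms(9)
  note op = chart_openin[OF U]
  note T = vector_field_tangent[OF X(1) u] vector_field_tangent[OF X(2) u] vector_field_tangent[OF X(3) u]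
  have derivative_terms: "v (tensor_map \<omega> [Y, Z]) = (\<Sum>p\<in>UNIV. \<Sum>q\<in>UNIV.
      v (a p q) * dx_op x p Y u * dx_op x q Z u
    + a p q u * v (dx_op x p Y) * dx_op x q Z u
    + a p q u * dx_op x p Y u * v (dx_op x q Z))"
    if "v \<in> tangent_space M u" "Y \<in> vector_fields M U" "Z \<in> vector_fields M U" for v Y Z
    by (rule tangent_two_tensor[OF U u that(1) a _ that(2,3)]) (rule \<omega>)
  have a_near: "smooth_near M u (a p q)" for p q
    by (rule smooth_fun_imp_smooth_near[OF a u])
  note dx_near = vector_field_dx_op_smooth[OF U X(1) u] vector_field_dx_op_smooth[OF U X(2) u]
    vector_field_dx_op_smooth[OF U X(3) u]
  have directional: "Y u f = (\<Sum>l\<in>UNIV. dx_op x l Y u * partial U x l f u)"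
    if "Y u \<in> tangent_space M u" "smooth_near M u f" for Y f
    using tangent_vector_in_coordinates[OF U u that] by (simp add: dx_op_def)
  have tensor3: "tensor3 A B C [X1, X2, X3] u = A X1 u * B X2 u * C X3 u" for A B C
    by (simp add: tensor3_def numeral_2_eq_2)
  \<comment> \<open>Each sum over \<open>l\<close> on the right-hand side is a directional derivative along one of the fields.\<close>
  have rhs:
    "(\<Sum>l\<in>UNIV. partial U x l (a p q) u * tensor3 (dx_op x l) (dx_op x p) (dx_op x q) [X1, X2, X3] u) =
      X1 u (a p q) * dx_op x p X2 u * dx_op x q X3 u"
    "(\<Sum>l\<in>UNIV. partial U x l (a p q) u * tensor3 (dx_op x p) (dx_op x l) (dx_op x q) [X1, X2, X3] u) =
      X2 u (a p q) * dx_op x p X1 u * dx_op x q X3 u"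
    "(\<Sum>l\<in>UNIV. partial U x l (a p q) u * tensor3 (dx_op x p) (dx_op x q) (dx_op x l) [X1, X2, X3] u) =
      X3 u (a p q) * dx_op x p X1 u * dx_op x q X2 u"
    "(\<Sum>l\<in>UNIV. a p q u * tensor3 (dx_op x l) (dx_op x p) (partial_dx_op U x l q) [X1, X2, X3] u) =
      a p q u * dx_op x p X2 u * X1 u (dx_op x q X3)"
    "(\<Sum>l\<in>UNIV. a p q u * tensor3 (dx_op x l) (dx_op x q) (partial_dx_op U x l p) [X1, X2, X3] u) =
      a p q u * dx_op x q X2 u * X1 u (dx_op x p X3)" for p q
    unfolding tensor3 partial_dx_op_def comp_def directional[of X1, OF T(1) a_near] directional[of X2, OF T(2) a_near]
      directional[of X3, OF T(3) a_near] directional[of X1, OF T(1) dx_near(3)] sum_distrib_left sum_distrib_right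
    by (intro sum.cong refl; simp add: algebra_simps)+
  have bracket_terms:
    "\<omega> u [bracket M X1 X2 u, X3 u] = (\<Sum>p\<in>UNIV. \<Sum>q\<in>UNIV.
      a p q u * ((X1 u (dx_op x p X2) - X2 u (dx_op x p X1)) * dx_op x q X3 u))"
    "\<omega> u [bracket M X1 X3 u, X2 u] = (\<Sum>p\<in>UNIV. \<Sum>q\<in>UNIV.
      a p q u * ((X1 u (dx_op x p X3) - X3 u (dx_op x p X1)) * dx_op x q X2 u))"
    "\<omega> u [X1 u, bracket M X2 X3 u] = (\<Sum>p\<in>UNIV. \<Sum>q\<in>UNIV.
      a p q u * (dx_op x p X1 u * (X2 u (dx_op x q X3) - X3 u (dx_op x q X2))))"
    using \<omega>[OF u bracket_tangent[OF op X(1,2) u] T(3)] \<omega>[OF u bracket_tangent[OF op X(1,3) u] T(2)]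
      \<omega>[OF u T(1) bracket_tangent[OF op X(2,3) u]]
    unfolding coord_covector_bracket[OF U u] dx_op_def[symmetric]
    by (simp_all only: dx_op_def)
  have "local_coboundary M \<omega> [X1, X2, X3] u = leibniz_coboundary M (tensor_map \<omega>) [X1, X2, X3] u"
    by (rule local_coboundary_eq[OF op _ u]) (use X in simp)
  then show ?thesis
    unfolding leibniz_coboundary_2 rhs bracket_terms
      derivative_terms[OF T(1) X(2,3)] derivative_terms[OF T(2) X(1,3)] derivative_terms[OF T(3) X(1,2)]
      sum.distrib[symmetric] sum_subtractf[symmetric]
    by (elim trans, intro sum.cong refl) (simp add: algebra_simps)
qed

end
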